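(* Consider the problem of minimizing $f(x)=\mathbb{E}[F(x;\omega)]$ over a convex polytope $\mathcal{X}$ of $\mathbb{R}^d$, where $f:\mathcal{X}\to\mathbb{R}$ is strictly concave. Suppose that $F(x;\omega)$ is continuously differentiable in $x$ for almost all $\omega\in\Omega$ and that there is a finite $V\ge 0$ with $\mathbb{E}[\|\nabla F(x;\omega)\|_2^2]\le V^2$ for all $x\in\mathcal{X}$. Then the last iterate of (lazy) stochastic gradient descent converges locally to local minima of $f$ with arbitrarily high probability: for every local minimum $x^*$ of $f$ over $\mathcal{X}$ there exists an open neighborhood $\mathcal{U}$ of $x^*$ such that, for every $\delta>0$ (with $\mathcal{U}$ independent of $\delta$), $$\mathbb{P}\left(\lim_{n\to\infty}X_n=x^*\mid X_1\in\mathcal{U}\right)\ge 1-\delta$$ provided that the step-size sequence $\gamma_n$ is small enough, in the sense that $\sum_{n=1}^\infty\gamma_n^2\le\eta$ for a suitable threshold $\eta=\eta(\delta)>0$.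
   Context: $\mathcal{X}\subset\mathbb{R}^d$ is a nonempty (compact) convex polytope, $\|\cdot\|_2$ is the Euclidean norm, $(\Omega,\mathcal{F},\mathbb{P})$ is a complete probability space, $F:\mathcal{X}\times\Omega\to\mathbb{R}$ is a stochastic objective, and $f(x)=\mathbb{E}[F(x;\omega)]$; gradients are with respect to $x$. Neighborhoods are relative to $\mathcal{X}$. Stochastic gradient descent (SGD, lazy version): $X_n=\Pi(Y_n)$, $Y_{n+1}=Y_n-\gamma_n\nabla F(X_n;\omega_n)$, $n=1,2,\dots$, where $\Pi(y)=\arg\min_{x\in\mathcal{X}}\|y-x\|_2$ is the Euclidean projection onto $\mathcal{X}$, $Y_1\in\mathbb{R}^d$ is a deterministic initialization (so conditioning on $X_1\in\mathcal{U}$ means that $\Pi(Y_1)\in\mathcal{U}$), $\omega_n$ are i.i.d. samples distributed according to $\mathbb{P}$, and the step-sizes $\gamma_n>0$ satisfy $\sum_n\gamma_n^2<\infty$ and $\sum_n\gamma_n=\infty$. *)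

theory Defs
  imports "HOL-Probability.Probability"
begin

definition strictly_concave_on :: "'a::real_vector set \<Rightarrow> ('a \<Rightarrow> real) \<Rightarrow> bool" where
  "strictly_concave_on X f \<longleftrightarrow>
     convex X \<and>
     (\<forall>x\<in>X. \<forall>y\<in>X. \<forall>t. x \<noteq> y \<and> 0 < t \<and> t < 1 \<longrightarrow>
        (1 - t) * f x + t * f y < f ((1 - t) *\<^sub>R x + t *\<^sub>R y))"

definition local_minimum_on :: "'a::topological_space set \<Rightarrow> ('a \<Rightarrow> real) \<Rightarrow> 'a \<Rightarrow> bool" where
  "local_minimum_on X f x \<longleftrightarrow>
     (\<exists>N. openin (top_of_set X) N \<and> x \<in> N \<and> (\<forall>y\<in>N. f x \<le> f y))"

(* The derivative is taken within X, since the objective is only meaningful on X. The gradient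
   field g is thereby determined on X up to vectors orthogonal to the affine hull of X, hence
   uniquely when X has nonempty interior. *)
definition continuously_differentiable_on_with_gradient ::
    "'a::euclidean_space set \<Rightarrow> ('a \<Rightarrow> real) \<Rightarrow> ('a \<Rightarrow> 'a) \<Rightarrow> bool" where
  "continuously_differentiable_on_with_gradient X h g \<longleftrightarrow>
     (\<forall>x\<in>X. (h has_derivative (\<lambda>v. g x \<bullet> v)) (at x within X)) \<and> continuous_on X g"

(* Lazy stochastic gradient descent along one sample path w, driven by the gradient oracle
   G x w = grad F(x; w). All sequences are indexed from 0, so index n here is iteration n + 1:
   lazy_sgd_score 0 is the initialization, and closest_point X is the Euclidean projection. *)
primrec lazy_sgd_score ::
    "'a::euclidean_space set \<Rightarrow> ('a \<Rightarrow> 'w \<Rightarrow> 'a) \<Rightarrow> (nat \<Rightarrow> real) \<Rightarrow> 'a \<Rightarrow> (nat \<Rightarrow> 'w) \<Rightarrow> nat \<Rightarrow> 'a"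
where
  "lazy_sgd_score X G \<gamma> y w 0 = y"
| "lazy_sgd_score X G \<gamma> y w (Suc n) =
     lazy_sgd_score X G \<gamma> y w n
       - \<gamma> n *\<^sub>R G (closest_point X (lazy_sgd_score X G \<gamma> y w n)) (w n)"

definition lazy_sgd ::
    "'a::euclidean_space set \<Rightarrow> ('a \<Rightarrow> 'w \<Rightarrow> 'a) \<Rightarrow> (nat \<Rightarrow> real) \<Rightarrow> 'a \<Rightarrow> (nat \<Rightarrow> 'w) \<Rightarrow> nat \<Rightarrow> 'a"
where
  "lazy_sgd X G \<gamma> y w n = closest_point X (lazy_sgd_score X G \<gamma> y w n)"

definition iid_samples :: "'s measure \<Rightarrow> 'w measure \<Rightarrow> (nat \<Rightarrow> 's \<Rightarrow> 'w) \<Rightarrow> bool" where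
  "iid_samples S M \<omega> \<longleftrightarrow>
     prob_space.indep_vars S (\<lambda>_. M) \<omega> UNIV \<and> (\<forall>n. distr S M (\<omega> n) = M)"

definition admissible_steps :: "(nat \<Rightarrow> real) \<Rightarrow> bool" where
  "admissible_steps \<gamma> \<longleftrightarrow>
     (\<forall>n. 0 < \<gamma> n) \<and> summable (\<lambda>n. (\<gamma> n)\<^sup>2) \<and> filterlim (\<lambda>n. \<Sum>k<n. \<gamma> k) at_top sequentially"

(* The gradient oracle is unconstrained on a null set of samples, so the iterates need not be
   measurable on S itself; they are measurable on the completion of S (equal to S if S is already
   complete), which is where the probability is taken. A set that is not measurable there
   would get the value 0. *)
definition lazy_sgd_convergence_prob ::
    "'s measure \<Rightarrow> (nat \<Rightarrow> 's \<Rightarrow> 'w) \<Rightarrow> 'a::euclidean_space set \<Rightarrow> ('a \<Rightarrow> 'w \<Rightarrow> 'a) \<Rightarrow>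
      (nat \<Rightarrow> real) \<Rightarrow> 'a \<Rightarrow> 'a \<Rightarrow> real"
where
  "lazy_sgd_convergence_prob S \<omega> X G \<gamma> y x =
     measure (completion S) {s \<in> space S. (\<lambda>n. lazy_sgd X G \<gamma> y (\<lambda>k. \<omega> k s) n) \<longlonglongrightarrow> x}"

end

theory Submission
  imports Defs
begin

text \<open>Write \<open>g x = \<E>[G x]\<close>. Uniform integrability makes \<open>g\<close> continuous, and strict concavity forces a
  local minimum \<open>p\<close> to satisfy \<open>g p \<bullet> (x - p) > 0\<close> for all \<open>x \<noteq> p\<close> in \<open>X\<close>; as \<open>X\<close> is a polytope, this
  improves to \<open>g x \<bullet> (x - p) \<ge> c * \<parallel>x - p\<parallel>\<close> for \<open>x\<close> near \<open>p\<close>. Along the dual iterates the energy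
  \<open>(\<parallel>Y - p\<parallel>\<^sup>2 - \<parallel>Y - \<Pi> Y\<parallel>\<^sup>2) / 2\<close> therefore decreases up to a square-integrable martingale noise and
  a drift \<open>\<gamma>\<^sup>2 * \<parallel>G\<parallel>\<^sup>2 / 2\<close>, and it equals \<open>\<parallel>X - p\<parallel>\<^sup>2 / 2\<close> near \<open>p\<close>. By Kolmogorov's and Markov's inequalities
  both perturbations stay below any fixed level with high probability once \<open>\<Sum>\<gamma>\<^sup>2\<close> is small, which traps
  the iterates near \<open>p\<close> for a neighborhood chosen before \<open>\<delta>\<close>. On this event both perturbation series
  converge almost surely, and \<open>\<Sum>\<gamma> = \<infinity>\<close> drives the energy to \<open>0\<close>.\<close>

subsection \<open>Energy descent and sharp minima of polytopes\<close>

text \<open>The Fenchel coupling between \<open>p\<close> and the dual point \<open>y\<close> for the regularizer \<open>\<parallel>x\<parallel>\<^sup>2 / 2\<close>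
  on \<open>X\<close>.\<close>

definition energy :: "'a::euclidean_space set \<Rightarrow> 'a \<Rightarrow> 'a \<Rightarrow> real" where
  "energy X p y = ((norm (y - p))\<^sup>2 - (norm (y - closest_point X y))\<^sup>2) / 2"

text \<open>Expanding the square around the projected point leaves a cross term whose sign is fixed
  by the obtuse-angle property of projections. The energy thus controls the distance of the iterate
  to \<open>p\<close>.\<close>

lemma norm_diff_le_energy:
  assumes "closed X" "convex X" "p \<in> X"
  shows "(norm (closest_point X y - p))\<^sup>2 / 2 \<le> energy X p y"
proof -
  let ?x = "closest_point X y"
  have "(y - ?x) \<bullet> (p - ?x) \<le> 0"
    using closest_point_dot assms by blast
  moreover have "(norm (y - p))\<^sup>2 = (norm (y - ?x))\<^sup>2 + (norm (?x - p))\<^sup>2 - 2 * ((y - ?x) \<bullet> (p - ?x))"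
    by (simp add: power2_norm_eq_inner algebra_simps inner_commute)
  ultimately show ?thesis
    by (simp add: energy_def)
qed

text \<open>If \<open>X\<close> contains the reflection of \<open>p\<close> in the projected point, then the residual \<open>y - closest_point X y\<close>
  is orthogonal to the direction of \<open>p\<close>. This keeps the energy small however far \<open>y\<close> is from \<open>X\<close>.\<close>

lemma energy_eq_norm_diff:
  assumes "closed X" "convex X" "p \<in> X" "2 *\<^sub>R closest_point X y - p \<in> X"
  shows "energy X p y = (norm (closest_point X y - p))\<^sup>2 / 2"
proof -
  let ?x = "closest_point X y"
  have "(y - ?x) \<bullet> (p - ?x) \<le> 0"
    using closest_point_dot assms by blast
  moreover have "(y - ?x) \<bullet> ((2 *\<^sub>R ?x - p) - ?x) \<le> 0"
    using closest_point_dot assms by blast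
  moreover have "(y - ?x) \<bullet> ((2 *\<^sub>R ?x - p) - ?x) = - ((y - ?x) \<bullet> (p - ?x))"
    by (simp add: algebra_simps scaleR_2)
  ultimately have "(y - ?x) \<bullet> (p - ?x) = 0"
    by linarith
  moreover have "(norm (y - p))\<^sup>2 = (norm (y - ?x))\<^sup>2 + (norm (?x - p))\<^sup>2 - 2 * ((y - ?x) \<bullet> (p - ?x))"
    by (simp add: power2_norm_eq_inner algebra_simps inner_commute)
  ultimately show ?thesis
    by (simp add: energy_def)
qed

text \<open>In \<open>y\<close> the energy has gradient \<open>closest_point X y - p\<close>, which
  is nonexpansive, so this is the descent inequality of a 1-smooth function. The proof computes the
  gap exactly in terms of the residuals \<open>N\<close> and \<open>N'\<close> of the two
  projections; both terms of the gap have the right sign.\<close>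

lemma energy_descent:
  assumes "closed X" "convex X" "X \<noteq> {}"
  shows "energy X p (y - v) \<le> energy X p y - v \<bullet> (closest_point X y - p) + (norm v)\<^sup>2 / 2"
proof -
  define x x' where "x = closest_point X y" and "x' = closest_point X (y - v)"
  define N N' where "N = y - x" and "N' = y - v - x'"
  have "x' \<in> X"
    unfolding x'_def using assms closest_point_in_set by blast
  then have "N \<bullet> (x' - x) \<le> 0"
    unfolding N_def x_def using closest_point_dot assms by blast
  moreover have "0 \<le> (norm (N - N'))\<^sup>2"
    by simp
  moreover have "energy X p (y - v) - (energy X p y - v \<bullet> (x - p) + (norm v)\<^sup>2 / 2)
      = N \<bullet> (x' - x) - (norm (N - N'))\<^sup>2 / 2"
  proof -
    have y: "y = x + N" and v: "v = x + N - x' - N'"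
      by (simp_all add: N_def N'_def)
    have e: "energy X p y = ((norm (y - p))\<^sup>2 - (norm N)\<^sup>2) / 2"
      "energy X p (y - v) = ((norm (y - v - p))\<^sup>2 - (norm N')\<^sup>2) / 2"
      by (simp_all add: energy_def N_def N'_def x_def x'_def)
    show ?thesis
      unfolding e unfolding v unfolding y
      by (simp add: power2_norm_eq_inner algebra_simps inner_commute diff_divide_distrib add_divide_distrib)
  qed
  ultimately show ?thesis
    unfolding x_def by linarith
qed

text \<open>A point of \<open>X\<close> is a convex combination of \<open>p\<close> and finitely
  many generators. The total weight off \<open>p\<close> bounds \<open>norm (x - p)\<close> from
  above and \<open>g \<bullet> (x - p)\<close> from below, each up to a constant, which gives linear
  growth. The reflection property feeds \<open>energy_eq_norm_diff\<close>.\<close>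

lemma polytope_sharp:
  fixes g p :: "'a::euclidean_space"
  assumes "polytope X" "p \<in> X" and pos: "\<And>x. x \<in> X \<Longrightarrow> x \<noteq> p \<Longrightarrow> 0 < g \<bullet> (x - p)"
  obtains c r where "0 < c" "0 < r" "\<And>x. x \<in> X \<Longrightarrow> c * norm (x - p) \<le> g \<bullet> (x - p)"
    "\<And>x. x \<in> X \<Longrightarrow> norm (x - p) < r \<Longrightarrow> 2 *\<^sub>R x - p \<in> X"
proof -
  obtain W where W: "finite W" "X = convex hull W"
    using assms(1) by (auto simp: polytope_def)
  \<comment> \<open>\<open>p\<close> need not be a generator; adjoining it makes the weight of
    \<open>p\<close> in a convex combination meaningful.\<close>
  define W' where "W' = insert p W"
  have W': "finite W'" "X = convex hull W'" "W' \<subseteq> X" "p \<in> W'"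
  proof -
    show "finite W'" "p \<in> W'" using W by (simp_all add: W'_def)
    show X: "X = convex hull W'"
      using W(2) assms(2) by (metis W'_def hull_redundant)
    show "W' \<subseteq> X"
      unfolding X by (rule hull_subset)
  qed
  \<comment> \<open>The inserted 1 keeps the minimum and the maximum defined and positive, even if
    \<open>p\<close> is the only generator.\<close>
  define m where "m = Min (insert 1 ((\<lambda>v. g \<bullet> (v - p)) ` (W' - {p})))"
  define D where "D = Max (insert 1 ((\<lambda>v. norm (v - p)) ` W'))"
  have m: "0 < m"
    unfolding m_def using W' pos by (subst Min_gr_iff) auto
  have m_le: "m \<le> g \<bullet> (v - p)" if "v \<in> W' - {p}" for v
    unfolding m_def using W' that by (intro Min_le) auto
  have D: "0 < D"
    unfolding D_def using W' by (subst Max_gr_iff) auto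
  have D_ge: "norm (v - p) \<le> D" if "v \<in> W'" for v
    unfolding D_def using W' that by (intro Max_ge) auto
  have decomp: "\<exists>u. (\<forall>v\<in>W'. 0 \<le> u v) \<and> sum u W' = 1 \<and> x = (\<Sum>v\<in>W'. u v *\<^sub>R v)
      \<and> x - p = (\<Sum>v\<in>W' - {p}. u v *\<^sub>R (v - p)) \<and> m * (\<Sum>v\<in>W' - {p}. u v) \<le> g \<bullet> (x - p)"
    if x_in: "x \<in> X" for x
  proof -
    obtain u where u: "\<forall>v\<in>W'. 0 \<le> u v" "sum u W' = 1" "x = (\<Sum>v\<in>W'. u v *\<^sub>R v)"
      using x_in unfolding W'(2) convex_hull_finite[OF W'(1)] mem_Collect_eq by metis
    have "x - p = (\<Sum>v\<in>W'. u v *\<^sub>R (v - p))"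
      using u(2,3) by (simp add: scaleR_right_diff_distrib sum_subtractf flip: scaleR_left.sum)
    also have "\<dots> = (\<Sum>v\<in>W' - {p}. u v *\<^sub>R (v - p))"
      using W' by (intro sum.mono_neutral_right) auto
    finally have x: "x - p = (\<Sum>v\<in>W' - {p}. u v *\<^sub>R (v - p))" .
    have "m * (\<Sum>v\<in>W' - {p}. u v) = (\<Sum>v\<in>W' - {p}. u v * m)"
      by (simp add: sum_distrib_left mult.commute)
    also have "\<dots> \<le> (\<Sum>v\<in>W' - {p}. u v * (g \<bullet> (v - p)))"
      using u m_le by (intro sum_mono mult_left_mono) auto
    also have "\<dots> = g \<bullet> (x - p)"
      by (simp add: x inner_sum_right)
    finally show ?thesis
      using u x by blast
  qed
  show ?thesis
  proof (rule that[of "m / D" "m / (2 * (norm g + 1))"])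
    show "0 < m / D" "0 < m / (2 * (norm g + 1))"
      using m D by (auto intro!: divide_pos_pos add_nonneg_pos)
  next
    fix x assume x: "x \<in> X"
    obtain u where u: "\<forall>v\<in>W'. 0 \<le> u v" "x - p = (\<Sum>v\<in>W' - {p}. u v *\<^sub>R (v - p))"
      "m * (\<Sum>v\<in>W' - {p}. u v) \<le> g \<bullet> (x - p)"
      using decomp[OF x] by blast
    have "norm (x - p) \<le> (\<Sum>v\<in>W' - {p}. norm (u v *\<^sub>R (v - p)))"
      unfolding u(2) by (rule norm_sum)
    also have "\<dots> \<le> (\<Sum>v\<in>W' - {p}. u v * D)"
      using u D_ge by (intro sum_mono) (auto intro: mult_left_mono)
    finally have "norm (x - p) \<le> (\<Sum>v\<in>W' - {p}. u v) * D"
      by (simp add: sum_distrib_right)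
    then have "norm (x - p) / D \<le> (\<Sum>v\<in>W' - {p}. u v)"
      using D by (simp add: field_simps)
    then have "m * (norm (x - p) / D) \<le> m * (\<Sum>v\<in>W' - {p}. u v)"
      using m by (intro mult_left_mono) auto
    then show "m / D * norm (x - p) \<le> g \<bullet> (x - p)"
      using u(3) by simp
  next
    fix x assume x: "x \<in> X" and small: "norm (x - p) < m / (2 * (norm g + 1))"
    obtain u where u: "\<forall>v\<in>W'. 0 \<le> u v" "sum u W' = 1" "x = (\<Sum>v\<in>W'. u v *\<^sub>R v)"
      "m * (\<Sum>v\<in>W' - {p}. u v) \<le> g \<bullet> (x - p)"
      using decomp[OF x] by blast
    \<comment> \<open>Close to \<open>p\<close> the slope is at most \<open>m / 2\<close>, so at
      most half of the weight lies off \<open>p\<close>. The 1 added to \<open>norm g\<close> avoids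
      a zero denominator.\<close>
    have "g \<bullet> (x - p) \<le> norm g * norm (x - p)"
      by (rule norm_cauchy_schwarz)
    also have "\<dots> \<le> (norm g + 1) * (m / (2 * (norm g + 1)))"
      using small by (intro mult_mono) auto
    also have "\<dots> = m / 2"
      using norm_ge_zero[of g] by (simp add: field_simps add_nonneg_eq_0_iff)
    finally have "m * (\<Sum>v\<in>W' - {p}. u v) \<le> m * (1 / 2)"
      using u(4) by simp
    then have "(\<Sum>v\<in>W' - {p}. u v) \<le> 1 / 2"
      using m by (simp only: mult_le_cancel_left_pos)
    then have up: "1 / 2 \<le> u p"
      using u(2) W' by (simp add: sum.remove[of W' p])
    \<comment> \<open>These are the weights of the reflected point: twice those of \<open>x\<close>
      minus a unit mass at \<open>p\<close>. They are nonnegative because \<open>p\<close> carries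
      at least half of the weight.\<close>
    define u' where "u' v = 2 * u v - (if v = p then 1 else 0)" for v
    have "\<forall>v\<in>W'. 0 \<le> u' v"
      using u(1) up by (auto simp: u'_def)
    moreover have "sum u' W' = 1"
      using u(2) W' by (simp add: u'_def sum_subtractf flip: sum_distrib_left)
    moreover have "(\<Sum>v\<in>W'. u' v *\<^sub>R v) = 2 *\<^sub>R x - p"
    proof -
      have "(\<Sum>v\<in>W'. u' v *\<^sub>R v) = (\<Sum>v\<in>W'. 2 *\<^sub>R (u v *\<^sub>R v) - (if v = p then v else 0))"
        by (intro sum.cong) (auto simp: u'_def algebra_simps)
      also have "\<dots> = 2 *\<^sub>R (\<Sum>v\<in>W'. u v *\<^sub>R v) - p"
        using W' by (simp add: sum_subtractf scaleR_right.sum)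
      finally show ?thesis using u(3) by simp
    qed
    ultimately show "2 *\<^sub>R x - p \<in> X"
      unfolding W'(2) convex_hull_finite[OF W'(1)] mem_Collect_eq by (intro exI[of _ u'] conjI)
  qed
qed

section \<open>A deterministic recursion with summable perturbation\<close>

text \<open>Beyond some \<open>N\<close> the perturbation adds less than
  \<open>\<epsilon> / 2\<close> over any window. If \<open>e\<close> stayed above
  \<open>\<epsilon> / 2\<close> from there on, the divergent step sum would push it below 0; so it
  dips below \<open>\<epsilon> / 2\<close>, and afterwards it cannot climb back to
  \<open>\<epsilon>\<close>.\<close>

lemma perturbed_descent_tendsto_zero:
  fixes e \<gamma> \<xi> :: "nat \<Rightarrow> real"
  assumes e: "\<And>n. 0 \<le> e n" and c: "0 < c" and \<gamma>: "\<And>n. 0 < \<gamma> n"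
    and step: "\<And>n. e (Suc n) \<le> e n - \<gamma> n * (c * sqrt (e n)) + \<xi> n"
    and \<xi>: "summable \<xi>" and div: "filterlim (\<lambda>n. \<Sum>k<n. \<gamma> k) at_top sequentially"
  shows "e \<longlonglongrightarrow> 0"
proof (rule LIMSEQ_I)
  fix \<epsilon> :: real assume \<epsilon>: "0 < \<epsilon>"
  obtain N where N: "\<And>m n. N \<le> m \<Longrightarrow> \<bar>sum \<xi> {m..<n}\<bar> < \<epsilon> / 2"
    using \<xi> \<epsilon> by (metis summable_Cauchy half_gt_zero real_norm_def)
  have bound: "e (m + k) \<le> e m - (\<Sum>i=m..<m + k. \<gamma> i * (c * sqrt (e i))) + sum \<xi> {m..<m + k}" for m k
  proof (induction k)
    case (Suc k)
    then show ?case using step[of "m + k"] by simp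
  qed simp
  have "\<exists>m\<ge>N. e m < \<epsilon> / 2"
  proof (rule ccontr)
    assume "\<not> ?thesis"
    then have large: "\<epsilon> / 2 \<le> e m" if "N \<le> m" for m
      using that by (meson not_le)
    define \<kappa> where "\<kappa> = c * sqrt (\<epsilon> / 2)"
    have \<kappa>: "0 < \<kappa>" using c \<epsilon> by (simp add: \<kappa>_def)
    \<comment> \<open>The steps from \<open>N\<close> to \<open>n\<close> are to outweigh the
      initial value \<open>e N\<close> together with the largest possible perturbation
      \<open>\<epsilon> / 2\<close>.\<close>
    obtain n where n: "N \<le> n" "(e N + \<epsilon> / 2) / \<kappa> + (\<Sum>k<N. \<gamma> k) < (\<Sum>k<n. \<gamma> k)"
      using div unfolding filterlim_at_top_dense eventually_sequentially by (meson nle_le)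
    have "(\<Sum>k<n. \<gamma> k) = (\<Sum>k<N. \<gamma> k) + (\<Sum>k=N..<n. \<gamma> k)"
      using n(1) by (simp add: sum.atLeastLessThan_concat lessThan_atLeast0)
    then have "(e N + \<epsilon> / 2) / \<kappa> < (\<Sum>k=N..<n. \<gamma> k)"
      using n(2) by linarith
    then have "e N + \<epsilon> / 2 < (\<Sum>k=N..<n. \<gamma> k) * \<kappa>"
      using \<kappa> by (simp add: field_simps)
    also have "\<dots> \<le> (\<Sum>k=N..<n. \<gamma> k * (c * sqrt (e k)))"
      unfolding sum_distrib_right \<kappa>_def using large \<gamma> c
      by (intro sum_mono mult_left_mono) (auto intro: less_imp_le)
    finally have "e n < 0"
      using bound[of N "n - N"] N[of N n] n(1) by simp
    then show False using e[of n] by simp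
  qed
  then obtain m where m: "N \<le> m" "e m < \<epsilon> / 2"
    by blast
  have "e n < \<epsilon>" if "m \<le> n" for n
  proof -
    have "0 \<le> (\<Sum>i=m..<n. \<gamma> i * (c * sqrt (e i)))"
      using \<gamma> c e by (intro sum_nonneg) (simp add: less_imp_le)
    then show ?thesis
      using bound[of m "n - m"] N[of m n] m that by simp
  qed
  then show "\<exists>no. \<forall>n\<ge>no. norm (e n - 0) < \<epsilon>"
    using e by (intro exI[of _ m]) simp
qed

subsection \<open>Measurability, moments and independence\<close>

text \<open>Replacing \<open>x\<close> by a nearby point of a countable dense set gives a function
  that is measurable in the pair, being pieced together from countably many sections. Continuity in
  \<open>x\<close> turns these approximations into a pointwise limit.\<close>

lemma borel_measurable_caratheodory:
  fixes h :: "'a::{metric_space, second_countable_topology} \<Rightarrow> 'w \<Rightarrow> 'b::metric_space"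
  assumes meas: "\<And>x. h x \<in> borel_measurable M"
    and cont: "\<And>\<omega>. \<omega> \<in> space M \<Longrightarrow> continuous_on UNIV (\<lambda>x. h x \<omega>)"
  shows "(\<lambda>(x, \<omega>). h x \<omega>) \<in> borel_measurable (borel \<Otimes>\<^sub>M M)"
proof -
  obtain D :: "'a set" where D: "countable D" "\<And>U. open U \<Longrightarrow> U \<noteq> {} \<Longrightarrow> \<exists>d\<in>D. d \<in> U"
    using countable_dense_exists by blast
  define d where "d = from_nat_into D"
  have dense: "\<exists>i. dist x (d i) < 1 / real (Suc n)" for x n
  proof -
    obtain z where "z \<in> D" "z \<in> ball x (1 / real (Suc n))"
      using D(2)[of "ball x (1 / real (Suc n))"] by auto
    moreover obtain i where "d i = z"
      unfolding d_def using from_nat_into_surj[OF D(1) \<open>z \<in> D\<close>] by blast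
    ultimately show ?thesis
      by (intro exI[of _ i]) simp
  qed
  \<comment> \<open>Taking the least admissible index makes the choice of the approximating point
    measurable in \<open>x\<close>.\<close>
  define k where "k n x = (LEAST i. dist x (d i) < 1 / real (Suc n))" for n x
  have k: "dist x (d (k n x)) < 1 / real (Suc n)" for n x
    unfolding k_def using dense by (rule LeastI_ex)
  have [measurable]: "k n \<in> borel \<rightarrow>\<^sub>M count_space UNIV" for n
    unfolding k_def by measurable
  show ?thesis
  proof (rule borel_measurable_LIMSEQ_metric)
    show "(\<lambda>p. h (d (k n (fst p))) (snd p)) \<in> borel_measurable (borel \<Otimes>\<^sub>M M)" for n
    proof (rule measurable_compose_countable[where g = "\<lambda>p. k n (fst p)" and f = "\<lambda>i p. h (d i) (snd p)"])
      show "(\<lambda>p. h (d i) (snd p)) \<in> borel_measurable (borel \<Otimes>\<^sub>M M)" for i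
        using meas by (rule measurable_compose[OF measurable_snd])
    qed measurable
  next
    fix p :: "'a \<times> 'w" assume "p \<in> space (borel \<Otimes>\<^sub>M M)"
    then have p: "snd p \<in> space M"
      by (auto simp: space_pair_measure)
    have "(\<lambda>n. dist (fst p) (d (k n (fst p)))) \<longlonglongrightarrow> 0"
    proof (rule tendsto_sandwich[OF _ _ tendsto_const])
      show "(\<lambda>n. 1 / real (Suc n)) \<longlonglongrightarrow> 0"
        by (rule LIMSEQ_inverse_real_of_nat[unfolded inverse_eq_divide])
      show "\<forall>\<^sub>F n in sequentially. dist (fst p) (d (k n (fst p))) \<le> 1 / real (Suc n)"
        using k by (intro always_eventually allI less_imp_le) auto
    qed auto
    then have lim: "(\<lambda>n. d (k n (fst p))) \<longlonglongrightarrow> fst p"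
      by (subst tendsto_dist_iff) (simp add: dist_commute)
    show "(\<lambda>n. h (d (k n (fst p))) (snd p)) \<longlonglongrightarrow> (case p of (x, \<omega>) \<Rightarrow> h x \<omega>)"
      using continuous_on_tendsto_compose[OF cont[OF p] lim] by (simp add: split_beta)
  qed
qed

section \<open>Second moments and passage to the limit\<close>

context prob_space
begin

lemma square_integrable_norm_imp_integrable:
  fixes u :: "'a \<Rightarrow> 'b::{banach, second_countable_topology}"
  assumes [measurable]: "u \<in> borel_measurable M" and "integrable M (\<lambda>x. (norm (u x))\<^sup>2)"
  shows "integrable M u"
proof -
  have "integrable M (\<lambda>x. norm (u x))"
    using assms by (intro square_integrable_imp_integrable[of "\<lambda>x. norm (u x)"]) measurable
  then show ?thesis
    using integrable_norm_iff[OF assms(1)] by blast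
qed

lemma integrable_mult_square_integrable:
  fixes u v :: "'a \<Rightarrow> real"
  assumes [measurable]: "u \<in> borel_measurable M" "v \<in> borel_measurable M"
    and "integrable M (\<lambda>x. (u x)\<^sup>2)" "integrable M (\<lambda>x. (v x)\<^sup>2)"
  shows "integrable M (\<lambda>x. u x * v x)"
proof (rule Bochner_Integration.integrable_bound)
  show "integrable M (\<lambda>x. (u x)\<^sup>2 + (v x)\<^sup>2)"
    using assms by auto
  show "AE x in M. norm (u x * v x) \<le> norm ((u x)\<^sup>2 + (v x)\<^sup>2)"
  proof (rule AE_I2)
    fix x
    show "norm (u x * v x) \<le> norm ((u x)\<^sup>2 + (v x)\<^sup>2)"
    proof -
      have "2 * (\<bar>u x\<bar> * \<bar>v x\<bar>) \<le> (u x)\<^sup>2 + (v x)\<^sup>2"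
        using sum_squares_bound[of "\<bar>u x\<bar>" "\<bar>v x\<bar>"] by (simp add: mult.assoc)
      moreover have "0 \<le> \<bar>u x\<bar> * \<bar>v x\<bar>"
        by simp
      moreover have "norm (u x * v x) = \<bar>u x\<bar> * \<bar>v x\<bar>" "norm ((u x)\<^sup>2 + (v x)\<^sup>2) = (u x)\<^sup>2 + (v x)\<^sup>2"
        by (simp_all add: abs_mult)
      ultimately show ?thesis
        by linarith
    qed
  qed
qed auto

text \<open>Bounded second moments give uniform integrability: the part of the difference beyond a
  level \<open>K\<close> contributes \<open>O(1/K)\<close>, the rest is handled by bounded convergence.\<close>

lemma tendsto_expectation_of_bounded_second_moment:
  fixes u :: "nat \<Rightarrow> 'a \<Rightarrow> 'b::{banach, second_countable_topology}"
  assumes [measurable]: "\<And>n. u n \<in> borel_measurable M" "v \<in> borel_measurable M"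
    and lim: "AE x in M. (\<lambda>n. u n x) \<longlonglongrightarrow> v x"
    and iu: "\<And>n. integrable M (\<lambda>x. (norm (u n x))\<^sup>2)" and iv: "integrable M (\<lambda>x. (norm (v x))\<^sup>2)"
    and bu: "\<And>n. expectation (\<lambda>x. (norm (u n x))\<^sup>2) \<le> C" and bv: "expectation (\<lambda>x. (norm (v x))\<^sup>2) \<le> C"
  shows "(\<lambda>n. expectation (u n)) \<longlonglongrightarrow> expectation v"
proof (rule LIMSEQ_I)
  fix \<epsilon> :: real assume \<epsilon>: "0 < \<epsilon>"
  have "0 \<le> expectation (\<lambda>x. (norm (v x))\<^sup>2)"
    by simp
  with bv have C: "0 \<le> C"
    by linarith
  \<comment> \<open>The second moment of the difference is at most \<open>4 * C\<close>, so its part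
    beyond level \<open>K\<close> costs at most \<open>4 * C / K\<close>. The summand 1 makes the
    comparison with \<open>\<epsilon> / 2\<close> strict and keeps \<open>K\<close> positive when
    \<open>C = 0\<close>.\<close>
  define K where "K = 8 * C / \<epsilon> + 1"
  have K: "0 < K" "4 * C / K < \<epsilon> / 2"
  proof -
    show "0 < K"
      using C \<epsilon> by (simp add: K_def add_nonneg_pos)
    then show "4 * C / K < \<epsilon> / 2"
      using \<epsilon> by (simp add: field_simps) (simp add: K_def field_simps)
  qed
  have int: "integrable M (u n)" "integrable M v" for n
    using square_integrable_norm_imp_integrable[OF _ iu] square_integrable_norm_imp_integrable[OF _ iv] assms(1,2)
    by blast+
  have sq: "(norm (u n x - v x))\<^sup>2 \<le> 2 * (norm (u n x))\<^sup>2 + 2 * (norm (v x))\<^sup>2" for n x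
  proof -
    have "(norm (u n x - v x))\<^sup>2 \<le> (norm (u n x) + norm (v x))\<^sup>2"
      by (intro power_mono norm_triangle_ineq4) auto
    also have "\<dots> \<le> 2 * (norm (u n x))\<^sup>2 + 2 * (norm (v x))\<^sup>2"
      using sum_squares_bound[of "norm (u n x)" "norm (v x)"] by (simp add: power2_sum)
    finally show ?thesis .
  qed
  have int_min: "integrable M (\<lambda>x. min (norm (u n x - v x)) K)" for n
    using K by (intro integrable_const_bound[where B = K]) auto
  have "(\<lambda>n. expectation (\<lambda>x. min (norm (u n x - v x)) K)) \<longlonglongrightarrow> expectation (\<lambda>x. 0)"
  proof (rule integral_dominated_convergence[where w = "\<lambda>_. K"])
    show "AE x in M. (\<lambda>n. min (norm (u n x - v x)) K) \<longlonglongrightarrow> 0"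
      using lim
    proof eventually_elim
      case (elim x)
      have "(\<lambda>n. norm (u n x - v x)) \<longlonglongrightarrow> 0"
        using elim by (simp add: tendsto_norm_zero LIM_zero)
      from tendsto_min[OF this tendsto_const[of K]] show ?case
        using K by simp
    qed
  qed (use K in auto)
  then have min_lim: "(\<lambda>n. expectation (\<lambda>x. min (norm (u n x - v x)) K)) \<longlonglongrightarrow> 0"
    by simp
  obtain N where N: "\<And>n. N \<le> n \<Longrightarrow> \<bar>expectation (\<lambda>x. min (norm (u n x - v x)) K)\<bar> < \<epsilon> / 2"
    using LIMSEQ_D[OF min_lim half_gt_zero[OF \<epsilon>]] by (metis diff_zero real_norm_def)
  have "norm (expectation (u n) - expectation v) < \<epsilon>" if "N \<le> n" for n
  proof -
    have "norm (expectation (u n) - expectation v) = norm (expectation (\<lambda>x. u n x - v x))"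
      using int by simp
    also have "\<dots> \<le> expectation (\<lambda>x. norm (u n x - v x))"
      by (rule integral_norm_bound)
    also have "\<dots> \<le> expectation (\<lambda>x. min (norm (u n x - v x)) K + (2 * (norm (u n x))\<^sup>2 + 2 * (norm (v x))\<^sup>2) / K)"
    proof (rule integral_mono)
      fix x
      have "norm (u n x - v x) \<le> min (norm (u n x - v x)) K + (norm (u n x - v x))\<^sup>2 / K"
      proof (cases "norm (u n x - v x) \<le> K")
        case False
        then have "K * norm (u n x - v x) \<le> (norm (u n x - v x))\<^sup>2"
          unfolding power2_eq_square by (intro mult_right_mono) auto
        then have "norm (u n x - v x) \<le> (norm (u n x - v x))\<^sup>2 / K"
          using K by (simp add: field_simps)
        moreover have "0 \<le> min (norm (u n x - v x)) K"
          using K by simp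
        ultimately show ?thesis by linarith
      qed (use K in simp)
      also have "\<dots> \<le> min (norm (u n x - v x)) K + (2 * (norm (u n x))\<^sup>2 + 2 * (norm (v x))\<^sup>2) / K"
        using K sq by (intro add_left_mono divide_right_mono) auto
      finally show "norm (u n x - v x) \<le> \<dots>" .
    qed (use int int_min iu iv in auto)
    also have "\<dots> = expectation (\<lambda>x. min (norm (u n x - v x)) K)
        + (2 * expectation (\<lambda>x. (norm (u n x))\<^sup>2) + 2 * expectation (\<lambda>x. (norm (v x))\<^sup>2)) / K"
      using int_min iu iv by simp
    also have "\<dots> \<le> expectation (\<lambda>x. min (norm (u n x - v x)) K) + 4 * C / K"
      using K bu[of n] bv by (intro add_left_mono divide_right_mono) auto
    also have "\<dots> < \<epsilon>"
      using N[OF that] K by linarith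
    finally show ?thesis .
  qed
  then show "\<exists>no. \<forall>n\<ge>no. norm (expectation (u n) - expectation v) < \<epsilon>"
    by blast
qed

section \<open>Averaging over a sample independent of the past\<close>

lemma measurable_subalgebra_ident: "subalgebra M F \<Longrightarrow> (\<lambda>x. x) \<in> M \<rightarrow>\<^sub>M F"
  using sets.sets_into_space[of _ F] by (auto simp: subalgebra_def measurable_def Int_absorb2 Pi_def)

text \<open>The identity, viewed as a random element of the coarser space \<open>F\<close>, carries
  the whole past. Independence makes the joint law with \<open>W\<close> agree with the product law
  on rectangles, which determines it.\<close>

lemma distr_pair_indep_subalgebra:
  assumes F: "subalgebra M F" and W: "W \<in> M \<rightarrow>\<^sub>M N"
    and ind: "indep_set (sets F) {W -` A \<inter> space M | A. A \<in> sets N}"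
  shows "distr M F (\<lambda>x. x) \<Otimes>\<^sub>M distr M N W = distr M (F \<Otimes>\<^sub>M N) (\<lambda>x. (x, W x))"
proof (rule pair_measure_eqI)
  note id = measurable_subalgebra_ident[OF F]
  interpret W: prob_space "distr M N W"
    using W by (rule prob_space_distr)
  interpret F: prob_space "distr M F (\<lambda>x. x)"
    using id by (rule prob_space_distr)
  show "sigma_finite_measure (distr M F (\<lambda>x. x))" "sigma_finite_measure (distr M N W)"
    by unfold_locales
  show "sets (distr M F (\<lambda>x. x) \<Otimes>\<^sub>M distr M N W) = sets (distr M (F \<Otimes>\<^sub>M N) (\<lambda>x. (x, W x)))"
    by (simp cong: sets_pair_measure_cong)
  fix A B assume "A \<in> sets (distr M F (\<lambda>x. x))" "B \<in> sets (distr M N W)"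
  then have A: "A \<in> sets F" and B: "B \<in> sets N" by simp_all
  have A': "A \<subseteq> space M" "A \<in> sets M"
    using sets.sets_into_space[OF A] F A by (auto simp: subalgebra_def)
  have "prob (A \<inter> (W -` B \<inter> space M)) = prob A * prob (W -` B \<inter> space M)"
    using ind A B by (intro indep_setD) auto
  moreover have "(\<lambda>x. (x, W x)) -` (A \<times> B) \<inter> space M = A \<inter> (W -` B \<inter> space M)"
    using A' by auto
  moreover have "(\<lambda>x. x) -` A \<inter> space M = A"
    using A' by auto
  ultimately show "emeasure (distr M F (\<lambda>x. x)) A * emeasure (distr M N W) B =
      emeasure (distr M (F \<Otimes>\<^sub>M N) (\<lambda>x. (x, W x))) (A \<times> B)"
    using A B by (simp add: emeasure_distr[OF id] emeasure_distr[OF W] emeasure_distr[OF measurable_Pair[OF id W]]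
        emeasure_eq_measure ennreal_mult)
qed

text \<open>The past is frozen while the fresh sample is averaged out. The nonnegative version needs
  no integrability and can therefore be used to establish it.\<close>

lemma nn_integral_indep_pair:
  assumes F: "subalgebra M F" and W: "W \<in> M \<rightarrow>\<^sub>M N"
    and ind: "indep_set (sets F) {W -` A \<inter> space M | A. A \<in> sets N}"
    and h: "h \<in> borel_measurable (F \<Otimes>\<^sub>M N)"
  shows "(\<integral>\<^sup>+x. h (x, W x) \<partial>M) = (\<integral>\<^sup>+x. \<integral>\<^sup>+w. h (x, w) \<partial>distr M N W \<partial>M)"
proof -
  note id = measurable_subalgebra_ident[OF F]
  note eq = distr_pair_indep_subalgebra[OF F W ind]
  interpret W: prob_space "distr M N W"
    using W by (rule prob_space_distr)
  have h': "h \<in> borel_measurable (F \<Otimes>\<^sub>M distr M N W)"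
    using h by (simp cong: measurable_cong_sets)
  have "(\<integral>\<^sup>+x. h (x, W x) \<partial>M) = (\<integral>\<^sup>+p. h p \<partial>distr M (F \<Otimes>\<^sub>M N) (\<lambda>x. (x, W x)))"
    by (subst nn_integral_distr[OF measurable_Pair[OF id W]]) (use h in simp_all)
  also have "\<dots> = (\<integral>\<^sup>+x. \<integral>\<^sup>+w. h (x, w) \<partial>distr M N W \<partial>distr M F (\<lambda>x. x))"
    unfolding eq[symmetric] using h by (intro W.nn_integral_fst[symmetric]) (simp cong: measurable_cong_sets)
  also have "\<dots> = (\<integral>\<^sup>+x. \<integral>\<^sup>+w. h (x, w) \<partial>distr M N W \<partial>M)"
    using W.borel_measurable_nn_integral_fst[OF h'] by (subst nn_integral_distr[OF id]) simp_all
  finally show ?thesis .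
qed

lemma expectation_indep_pair:
  fixes h :: "_ \<Rightarrow> 'b::{banach, second_countable_topology}"
  assumes F: "subalgebra M F" and W: "W \<in> M \<rightarrow>\<^sub>M N"
    and ind: "indep_set (sets F) {W -` A \<inter> space M | A. A \<in> sets N}"
    and h: "h \<in> borel_measurable (F \<Otimes>\<^sub>M N)" and int: "integrable M (\<lambda>x. h (x, W x))"
  shows "expectation (\<lambda>x. h (x, W x)) = expectation (\<lambda>x. \<integral>w. h (x, w) \<partial>distr M N W)"
proof -
  note id = measurable_subalgebra_ident[OF F]
  note eq = distr_pair_indep_subalgebra[OF F W ind]
  interpret W: prob_space "distr M N W"
    using W by (rule prob_space_distr)
  interpret F: prob_space "distr M F (\<lambda>x. x)"
    using id by (rule prob_space_distr)
  interpret P: pair_sigma_finite "distr M F (\<lambda>x. x)" "distr M N W" ..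
  have h': "h \<in> borel_measurable (F \<Otimes>\<^sub>M distr M N W)"
    using h by (simp cong: measurable_cong_sets)
  have "expectation (\<lambda>x. h (x, W x)) = (\<integral>p. h p \<partial>distr M (F \<Otimes>\<^sub>M N) (\<lambda>x. (x, W x)))"
    using integral_distr[OF measurable_Pair[OF id W] h] by simp
  also have "\<dots> = (\<integral>x. \<integral>w. h (x, w) \<partial>distr M N W \<partial>distr M F (\<lambda>x. x))"
    unfolding eq[symmetric]
  proof (rule P.integral_fst'[symmetric])
    show "integrable (distr M F (\<lambda>x. x) \<Otimes>\<^sub>M distr M N W) h"
      unfolding eq integrable_distr_eq[OF measurable_Pair[OF id W] h] using int by simp
  qed
  also have "\<dots> = expectation (\<lambda>x. \<integral>w. h (x, w) \<partial>distr M N W)"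
  proof (rule integral_distr[OF id])
    show "(\<lambda>x. \<integral>w. h (x, w) \<partial>distr M N W) \<in> borel_measurable F"
      using h' by (intro W.borel_measurable_lebesgue_integral) simp
  qed
  finally show ?thesis .
qed

end

subsection \<open>Square-integrable martingales\<close>

text \<open>Instead of vanishing conditional expectations, \<open>orthogonal\<close> asks for
  orthogonality to every square-integrable variable known at time \<open>n\<close>. This is the form
  in which cross terms of second moments appear.\<close>

locale square_integrable_martingale_differences = prob_space M for M :: "'s measure" +
  fixes F :: "nat \<Rightarrow> 's measure" and D :: "nat \<Rightarrow> 's \<Rightarrow> real"
  assumes subalg: "\<And>n. subalgebra M (F n)"
    and sets_mono: "\<And>m n. m \<le> n \<Longrightarrow> sets (F m) \<subseteq> sets (F n)"
    and adapted: "\<And>n. D n \<in> borel_measurable (F (Suc n))"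
    and square_integrable: "\<And>n. integrable M (\<lambda>x. (D n x)\<^sup>2)"
    and orthogonal: "\<And>n Z. Z \<in> borel_measurable (F n) \<Longrightarrow> integrable M (\<lambda>x. (Z x)\<^sup>2) \<Longrightarrow>
      expectation (\<lambda>x. Z x * D n x) = 0"
begin

text \<open>Restarting the sequence at time \<open>m\<close> lets the maximal inequality be applied
  to tails of the series.\<close>

lemma shifted: "square_integrable_martingale_differences M (\<lambda>n. F (m + n)) (\<lambda>n. D (m + n))"
  using subalg sets_mono adapted square_integrable orthogonal
  by unfold_locales auto

lemma measurable_mono:
  assumes "m \<le> n" "Z \<in> borel_measurable (F m)"
  shows "Z \<in> borel_measurable (F n)"
proof -
  have "subalgebra (F n) (F m)"
    using assms(1) subalg sets_mono by (auto simp: subalgebra_def)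
  then show ?thesis
    using assms(2) measurable_from_subalg by blast
qed

definition partial_sum :: "nat \<Rightarrow> 's \<Rightarrow> real" where
  "partial_sum n x = (\<Sum>k<n. D k x)"

lemma partial_sum_adapted: "partial_sum n \<in> borel_measurable (F n)"
  unfolding partial_sum_def using measurable_mono[OF _ adapted]
  by (intro borel_measurable_sum) (simp add: Suc_leI)

lemma partial_sum_measurable [measurable]: "partial_sum n \<in> borel_measurable M"
  using measurable_from_subalg[OF subalg partial_sum_adapted] .

lemma D_measurable [measurable]: "D n \<in> borel_measurable M"
  using measurable_from_subalg[OF subalg adapted] .

lemma partial_sum_square_integrable: "integrable M (\<lambda>x. (partial_sum n x)\<^sup>2)"
proof (induction n)
  case 0
  then show ?case by (simp add: partial_sum_def)
next
  case (Suc n)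
  have "integrable M (\<lambda>x. (partial_sum n x)\<^sup>2 + (D n x)\<^sup>2 + 2 * (partial_sum n x * D n x))"
    using Suc square_integrable integrable_mult_square_integrable
    by (intro Bochner_Integration.integrable_add integrable_mult_right) auto
  then show ?case
    by (simp add: partial_sum_def power2_sum mult.assoc)
qed

text \<open>The cross term vanishes because the partial sum restricted to \<open>A\<close> is known
  at time \<open>n\<close> and square-integrable, hence orthogonal to the next increment.\<close>

lemma expectation_indicator_square_Suc:
  assumes A: "A \<in> sets (F n)"
  shows "expectation (\<lambda>x. indicator A x * (partial_sum (Suc n) x)\<^sup>2) =
    expectation (\<lambda>x. indicator A x * (partial_sum n x)\<^sup>2) + expectation (\<lambda>x. indicator A x * (D n x)\<^sup>2)"
proof -
  have A' [measurable]: "A \<in> sets M"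
    using A subalg by (auto simp: subalgebra_def)
  have sq: "integrable M (\<lambda>x. (indicator A x * partial_sum n x)\<^sup>2)"
  proof -
    have "(indicator A x * partial_sum n x)\<^sup>2 = (partial_sum n x)\<^sup>2 * indicator A x" for x
      by (simp add: indicator_def)
    then show ?thesis
      using integrable_real_mult_indicator[OF A' partial_sum_square_integrable[of n]] by simp
  qed
  have "expectation (\<lambda>x. (indicator A x * partial_sum n x) * D n x) = 0"
    using A partial_sum_adapted sq by (intro orthogonal borel_measurable_times) auto
  moreover have "integrable M (\<lambda>x. (indicator A x * partial_sum n x) * D n x)"
    using sq square_integrable by (intro integrable_mult_square_integrable) auto
  moreover have "integrable M (\<lambda>x. indicator A x * (partial_sum n x)\<^sup>2)" "integrable M (\<lambda>x. indicator A x * (D n x)\<^sup>2)"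
    using integrable_real_mult_indicator[OF A' partial_sum_square_integrable[of n]]
      integrable_real_mult_indicator[OF A' square_integrable[of n]]
    by (simp_all add: mult.commute)
  moreover have "indicator A x * (partial_sum (Suc n) x)\<^sup>2 = indicator A x * (partial_sum n x)\<^sup>2
      + indicator A x * (D n x)\<^sup>2 + 2 * ((indicator A x * partial_sum n x) * D n x)" for x
    by (simp add: partial_sum_def power2_sum algebra_simps)
  ultimately show ?thesis
    by simp
qed

lemma expectation_indicator_square_mono:
  assumes A: "A \<in> sets (F k)" and "k \<le> n"
  shows "expectation (\<lambda>x. indicator A x * (partial_sum k x)\<^sup>2) \<le> expectation (\<lambda>x. indicator A x * (partial_sum n x)\<^sup>2)"
  using \<open>k \<le> n\<close>
proof (induction n rule: dec_induct)
  case (step n)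
  have "0 \<le> expectation (\<lambda>x. indicator A x * (D n x)\<^sup>2)"
    by (intro integral_nonneg_AE) auto
  moreover have "A \<in> sets (F n)"
    using A sets_mono step(1) by blast
  ultimately show ?case
    using step(3) expectation_indicator_square_Suc[of A n] by linarith
qed simp

lemma expectation_partial_sum_square:
  "expectation (\<lambda>x. (partial_sum n x)\<^sup>2) = (\<Sum>k<n. expectation (\<lambda>x. (D k x)\<^sup>2))"
proof (induction n)
  case 0
  then show ?case by (simp add: partial_sum_def)
next
  case (Suc n)
  have "space M \<in> sets (F n)"
    using subalg[of n] by (metis sets.top subalgebra_def)
  from expectation_indicator_square_Suc[OF this] show ?case
    using Suc by (simp cong: Bochner_Integration.integral_cong)
qed

text \<open>Kolmogorov's inequality: split the event according to the first time \<open>k\<close> at which the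
  level is reached; that event is known at time \<open>k\<close>, hence the later increments only add to the
  second moment on it.\<close>

lemma maximal_inequality:
  assumes \<epsilon>: "0 < \<epsilon>"
  shows "prob {x \<in> space M. \<exists>k\<le>n. \<epsilon> \<le> \<bar>partial_sum k x\<bar>} \<le> (\<Sum>k<n. expectation (\<lambda>x. (D k x)\<^sup>2)) / \<epsilon>\<^sup>2"
proof -
  define B where "B k = {x \<in> space M. \<epsilon> \<le> \<bar>partial_sum k x\<bar> \<and> (\<forall>j<k. \<bar>partial_sum j x\<bar> < \<epsilon>)}" for k
  have BF: "B k \<in> sets (F k)" for k
  proof -
    have sets: "{x \<in> space (F k). \<bar>partial_sum j x\<bar> < \<epsilon>} \<in> sets (F k)"
      "{x \<in> space (F k). \<epsilon> \<le> \<bar>partial_sum j x\<bar>} \<in> sets (F k)" if "j \<le> k" for j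
    proof -
      note [measurable] = measurable_mono[OF that partial_sum_adapted]
      show "{x \<in> space (F k). \<bar>partial_sum j x\<bar> < \<epsilon>} \<in> sets (F k)"
        "{x \<in> space (F k). \<epsilon> \<le> \<bar>partial_sum j x\<bar>} \<in> sets (F k)"
        by measurable
    qed
    have "{x \<in> space (F k). \<epsilon> \<le> \<bar>partial_sum k x\<bar> \<and> (\<forall>j\<in>{..<k}. \<bar>partial_sum j x\<bar> < \<epsilon>)} \<in> sets (F k)"
      by (intro sets.sets_Collect_conj sets.sets_Collect_finite_All sets) auto
    moreover have "space (F k) = space M"
      using subalg by (simp add: subalgebra_def)
    ultimately show ?thesis
      by (simp add: B_def Ball_def)
  qed
  then have B [measurable]: "B k \<in> sets M" for k
    using subalg by (auto simp: subalgebra_def)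
  have disj: "disjoint_family_on B {..n}"
  proof -
    have "\<not> k < l" if "x \<in> B k" "x \<in> B l" for k l x
      using that leD unfolding B_def by blast
    then show ?thesis
      unfolding disjoint_family_on_def by (metis disjoint_iff linorder_neqE_nat)
  qed
  have "{x \<in> space M. \<exists>k\<le>n. \<epsilon> \<le> \<bar>partial_sum k x\<bar>} = (\<Union>k\<le>n. B k)"
  proof (intro equalityI subsetI)
    fix x assume "x \<in> {x \<in> space M. \<exists>k\<le>n. \<epsilon> \<le> \<bar>partial_sum k x\<bar>}"
    then obtain k where k: "x \<in> space M" "k \<le> n" "\<epsilon> \<le> \<bar>partial_sum k x\<bar>"
      by blast
    define l where "l = (LEAST k. \<epsilon> \<le> \<bar>partial_sum k x\<bar>)"
    have "\<epsilon> \<le> \<bar>partial_sum l x\<bar>"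
      unfolding l_def using k(3) by (rule LeastI)
    moreover have "l \<le> k"
      unfolding l_def using k(3) by (rule Least_le)
    moreover have "\<bar>partial_sum j x\<bar> < \<epsilon>" if "j < l" for j
      using not_less_Least[OF that[unfolded l_def]] by simp
    ultimately show "x \<in> (\<Union>k\<le>n. B k)"
      using k by (auto simp: B_def)
  qed (auto simp: B_def)
  then have "prob {x \<in> space M. \<exists>k\<le>n. \<epsilon> \<le> \<bar>partial_sum k x\<bar>} = (\<Sum>k\<le>n. prob (B k))"
    using disj by (simp add: finite_measure_finite_Union image_subset_iff)
  also have "\<dots> \<le> (\<Sum>k\<le>n. expectation (\<lambda>x. indicator (B k) x * (partial_sum n x)\<^sup>2) / \<epsilon>\<^sup>2)"
  proof (rule sum_mono)
    fix k assume "k \<in> {..n}"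
    then have k: "k \<le> n" by simp
    have "\<epsilon>\<^sup>2 * prob (B k) = expectation (\<lambda>x. indicator (B k) x * \<epsilon>\<^sup>2)"
      by (simp add: mult.commute)
    also have "\<dots> \<le> expectation (\<lambda>x. indicator (B k) x * (partial_sum k x)\<^sup>2)"
    proof (rule integral_mono)
      show "integrable M (\<lambda>x. indicator (B k) x * (partial_sum k x)\<^sup>2)"
        using integrable_real_mult_indicator[OF B partial_sum_square_integrable]
        by (simp add: mult.commute)
      show "indicator (B k) x * \<epsilon>\<^sup>2 \<le> indicator (B k) x * (partial_sum k x)\<^sup>2" for x
        using \<epsilon> by (auto simp: indicator_def B_def abs_le_square_iff[symmetric])
      show "integrable M (\<lambda>x. indicator (B k) x * \<epsilon>\<^sup>2)"
        by (intro integrable_mult_left integrable_real_indicator B) (simp add: emeasure_eq_measure)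
    qed
    also have "\<dots> \<le> expectation (\<lambda>x. indicator (B k) x * (partial_sum n x)\<^sup>2)"
      using BF k by (rule expectation_indicator_square_mono)
    finally show "prob (B k) \<le> expectation (\<lambda>x. indicator (B k) x * (partial_sum n x)\<^sup>2) / \<epsilon>\<^sup>2"
      using \<epsilon> by (simp add: field_simps)
  qed
  also have "\<dots> = expectation (\<lambda>x. \<Sum>k\<le>n. indicator (B k) x * (partial_sum n x)\<^sup>2) / \<epsilon>\<^sup>2"
  proof -
    have "integrable M (\<lambda>x. indicator (B k) x * (partial_sum n x)\<^sup>2)" for k
      using integrable_real_mult_indicator[OF B partial_sum_square_integrable]
      by (simp add: mult.commute)
    then show ?thesis
      by (subst Bochner_Integration.integral_sum) (auto simp: sum_divide_distrib)
  qed
  also have "\<dots> \<le> expectation (\<lambda>x. (partial_sum n x)\<^sup>2) / \<epsilon>\<^sup>2"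
  proof (intro divide_right_mono integral_mono)
    \<comment> \<open>At most one of the disjoint first-passage events occurs, so no part of the
      second moment is counted twice.\<close>
    show "(\<Sum>k\<le>n. indicator (B k) x * (partial_sum n x)\<^sup>2) \<le> (partial_sum n x)\<^sup>2" for x
    proof -
      have "(\<Sum>k\<le>n. indicator (B k) x :: real) = indicator (\<Union>k\<le>n. B k) x"
        using disj by (simp add: indicator_UN_disjoint)
      also have "\<dots> \<le> 1"
        by (simp add: indicator_def)
      finally show ?thesis
        by (simp add: mult_left_le_one_le sum_nonneg flip: sum_distrib_right)
    qed
    show "integrable M (\<lambda>x. \<Sum>k\<le>n. indicator (B k) x * (partial_sum n x)\<^sup>2)"
      using integrable_real_mult_indicator[OF B partial_sum_square_integrable]
      by (intro Bochner_Integration.integrable_sum) (simp add: mult.commute)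
  qed (auto simp: partial_sum_square_integrable)
  finally show ?thesis
    by (simp add: expectation_partial_sum_square)
qed

lemma maximal_inequality_infinite:
  assumes \<epsilon>: "0 < \<epsilon>" and sm: "summable (\<lambda>k. expectation (\<lambda>x. (D k x)\<^sup>2))"
  shows "prob {x \<in> space M. \<exists>k. \<epsilon> \<le> \<bar>partial_sum k x\<bar>} \<le> (\<Sum>k. expectation (\<lambda>x. (D k x)\<^sup>2)) / \<epsilon>\<^sup>2"
proof -
  define A where "A n = {x \<in> space M. \<exists>k\<le>n. \<epsilon> \<le> \<bar>partial_sum k x\<bar>}" for n
  have [measurable]: "A n \<in> sets M" for n
    unfolding A_def by measurable
  have inc: "incseq A"
    unfolding A_def incseq_def by (auto intro: order_trans)
  have lim: "(\<lambda>n. prob (A n)) \<longlonglongrightarrow> prob (\<Union>n. A n)"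
    using inc by (intro finite_Lim_measure_incseq) auto
  have "(\<Union>n. A n) = {x \<in> space M. \<exists>k. \<epsilon> \<le> \<bar>partial_sum k x\<bar>}"
    by (auto simp: A_def)
  moreover have "prob (A n) \<le> (\<Sum>k. expectation (\<lambda>x. (D k x)\<^sup>2)) / \<epsilon>\<^sup>2" for n
  proof -
    have "prob (A n) \<le> (\<Sum>k<n. expectation (\<lambda>x. (D k x)\<^sup>2)) / \<epsilon>\<^sup>2"
      unfolding A_def using \<epsilon> by (rule maximal_inequality)
    also have "\<dots> \<le> (\<Sum>k. expectation (\<lambda>x. (D k x)\<^sup>2)) / \<epsilon>\<^sup>2"
      using sm by (intro divide_right_mono sum_le_suminf) auto
    finally show ?thesis .
  qed
  ultimately show ?thesis
    using LIMSEQ_le_const2[OF lim] by auto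
qed

text \<open>Let \<open>A\<close> be the event that after no time \<open>m\<close> all partial sums
  started at \<open>m\<close> stay below \<open>\<epsilon>\<close>. For every \<open>m\<close> the
  maximal inequality bounds its probability by a tail of the second-moment series, so it is null.
  Running through the levels \<open>1 / real (Suc j)\<close> gives Cauchy's criterion outside one
  null set.\<close>

lemma AE_summable:
  assumes sm: "summable (\<lambda>k. expectation (\<lambda>x. (D k x)\<^sup>2))"
  shows "AE x in M. summable (\<lambda>k. D k x)"
proof -
  have ex: "AE x in M. \<exists>m. \<forall>k. \<bar>\<Sum>i<k. D (m + i) x\<bar> < \<epsilon>" if \<epsilon>: "0 < \<epsilon>" for \<epsilon>
  proof -
    define A where "A = {x \<in> space M. \<not> (\<exists>m. \<forall>k. \<bar>\<Sum>i<k. D (m + i) x\<bar> < \<epsilon>)}"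
    have A [measurable]: "A \<in> sets M"
      unfolding A_def by measurable
    have bound: "prob A \<le> (\<Sum>k. expectation (\<lambda>x. (D (k + m) x)\<^sup>2)) / \<epsilon>\<^sup>2" for m
    proof -
      interpret m: square_integrable_martingale_differences M "\<lambda>n. F (m + n)" "\<lambda>n. D (m + n)"
        by (rule shifted)
      have ps: "m.partial_sum k x = (\<Sum>i<k. D (m + i) x)" for k x
        by (simp add: m.partial_sum_def)
      have "prob A \<le> prob {x \<in> space M. \<exists>k. \<epsilon> \<le> \<bar>m.partial_sum k x\<bar>}"
        by (intro finite_measure_mono) (auto simp: A_def ps not_less)
      also have "\<dots> \<le> (\<Sum>k. expectation (\<lambda>x. (D (m + k) x)\<^sup>2)) / \<epsilon>\<^sup>2"
        using \<epsilon> sm summable_iff_shift[of "\<lambda>k. expectation (\<lambda>x. (D k x)\<^sup>2)" m]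
        by (intro m.maximal_inequality_infinite) (auto simp: add.commute)
      finally show ?thesis
        by (simp add: add.commute)
    qed
    have "(\<lambda>m. (\<Sum>k. expectation (\<lambda>x. (D (k + m) x)\<^sup>2)) / \<epsilon>\<^sup>2) \<longlonglongrightarrow> 0 / \<epsilon>\<^sup>2"
      using sm \<epsilon> by (intro tendsto_divide tendsto_const suminf_exist_split2) auto
    then have "prob A \<le> 0"
      using bound by (intro LIMSEQ_le_const) auto
    then have "prob A = 0"
      using measure_nonneg[of M A] by linarith
    then have "A \<in> null_sets M"
      using A by (simp add: null_sets_def emeasure_eq_measure)
    then show ?thesis
      by (rule AE_I') (auto simp: A_def)
  qed
  have "AE x in M. \<forall>j. \<exists>m. \<forall>k. \<bar>\<Sum>i<k. D (m + i) x\<bar> < 1 / real (Suc j)"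
    by (subst AE_all_countable) (intro allI ex, simp)
  then show ?thesis
  proof eventually_elim
    case (elim x)
    show ?case
      unfolding summable_Cauchy
    proof (intro allI impI)
      fix e :: real assume "0 < e"
      then obtain j where j: "1 / real (Suc j) < e / 2"
        using nat_approx_posE[of "e / 2"] by auto
      obtain N where N: "\<And>k. \<bar>\<Sum>i<k. D (N + i) x\<bar> < 1 / real (Suc j)"
        using elim by blast
      have tail: "\<bar>\<Sum>i=N..<n. D i x\<bar> < e / 2" if "N \<le> n" for n
      proof -
        have "(\<Sum>i=N..<n. D i x) = (\<Sum>i<n - N. D (N + i) x)"
          using that sum.shift_bounds_nat_ivl[of "\<lambda>i. D i x" 0 N "n - N"]
          by (simp add: lessThan_atLeast0 add.commute)
        then show ?thesis using N[of "n - N"] j by linarith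
      qed
      have "norm (\<Sum>i=m..<n. D i x) < e" if "N \<le> m" for m n
      proof (cases "m \<le> n")
        case True
        then have "(\<Sum>i=m..<n. D i x) = (\<Sum>i=N..<n. D i x) - (\<Sum>i=N..<m. D i x)"
          using that by (simp add: sum_diff_nat_ivl)
        then show ?thesis
          using tail[of m] tail[of n] that True by simp
      qed (use \<open>0 < e\<close> in simp)
      then show "\<exists>N. \<forall>m\<ge>N. \<forall>n. norm (\<Sum>i=m..<n. D i x) < e"
        by blast
    qed
  qed
qed

end

section \<open>Series of nonnegative random variables\<close>

text \<open>Nonnegative terms make the exceedance events increase with \<open>n\<close>, so Markov's
  inequality for each finite sum passes to their union.\<close>

lemma (in prob_space) nonneg_series_maximal_inequality:
  fixes Q :: "nat \<Rightarrow> 'a \<Rightarrow> real"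
  assumes int: "\<And>n. integrable M (Q n)" and nonneg: "\<And>n x. 0 \<le> Q n x" and \<epsilon>: "0 < \<epsilon>"
    and C: "\<And>n. (\<Sum>k<n. expectation (Q k)) \<le> C"
  shows "prob {x \<in> space M. \<exists>n. \<epsilon> \<le> (\<Sum>k<n. Q k x)} \<le> C / \<epsilon>"
proof -
  define A where "A n = {x \<in> space M. \<epsilon> \<le> (\<Sum>k<n. Q k x)}" for n
  have [measurable]: "Q n \<in> borel_measurable M" for n
    using int by (rule borel_measurable_integrable)
  have A: "A n \<in> sets M" for n
    unfolding A_def by measurable
  have "A n \<subseteq> A (Suc n)" for n
    using nonneg by (auto simp: A_def intro: add_increasing2)
  then have "incseq A"
    by (rule incseq_SucI)
  then have lim: "(\<lambda>n. prob (A n)) \<longlonglongrightarrow> prob (\<Union>n. A n)"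
    using A by (intro finite_Lim_measure_incseq) auto
  have bound: "prob (A n) \<le> C / \<epsilon>" for n
  proof -
    have "prob (A n) \<le> expectation (\<lambda>x. \<Sum>k<n. Q k x) / \<epsilon>"
      unfolding A_def using int nonneg \<epsilon>
      by (intro integral_Markov_inequality_measure[of _ _ "{}"]) (auto intro!: AE_I2 sum_nonneg)
    also have "\<dots> \<le> C / \<epsilon>"
      using C[of n] \<epsilon> int by (simp add: divide_right_mono)
    finally show ?thesis .
  qed
  have "(\<Union>n. A n) = {x \<in> space M. \<exists>n. \<epsilon> \<le> (\<Sum>k<n. Q k x)}"
    by (auto simp: A_def)
  then show ?thesis
    using LIMSEQ_le_const2[OF lim] bound by auto
qed

text \<open>Unbounded partial sums exceed every level, so the divergence event has probability at
  most \<open>C / real (Suc j)\<close> for all \<open>j\<close>.\<close>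

lemma (in prob_space) AE_summable_nonneg:
  fixes Q :: "nat \<Rightarrow> 'a \<Rightarrow> real"
  assumes int: "\<And>n. integrable M (Q n)" and nonneg: "\<And>n x. 0 \<le> Q n x"
    and C: "\<And>n. (\<Sum>k<n. expectation (Q k)) \<le> C"
  shows "AE x in M. summable (\<lambda>n. Q n x)"
proof -
  define A where "A = {x \<in> space M. \<forall>j. \<exists>n. real (Suc j) \<le> (\<Sum>k<n. Q k x)}"
  have [measurable]: "Q n \<in> borel_measurable M" for n
    using int by (rule borel_measurable_integrable)
  have A [measurable]: "A \<in> sets M"
    unfolding A_def by measurable
  have bound: "prob A \<le> C / real (Suc j)" for j
  proof -
    have "prob A \<le> prob {x \<in> space M. \<exists>n. real (Suc j) \<le> (\<Sum>k<n. Q k x)}"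
      by (intro finite_measure_mono) (auto simp: A_def simp del: of_nat_Suc)
    also have "\<dots> \<le> C / real (Suc j)"
      using int nonneg C by (intro nonneg_series_maximal_inequality) auto
    finally show ?thesis .
  qed
  have "(\<lambda>j. C * (1 / real (Suc j))) \<longlonglongrightarrow> C * 0"
    using LIMSEQ_inverse_real_of_nat by (intro tendsto_mult tendsto_const) (simp add: inverse_eq_divide)
  then have "prob A \<le> C * 0"
    using bound by (intro LIMSEQ_le_const) auto
  then have "prob A = 0"
    using measure_nonneg[of M A] by simp
  then have "A \<in> null_sets M"
    using A by (simp add: null_sets_def emeasure_eq_measure)
  then have "AE x in M. x \<notin> A"
    by (rule AE_not_in)
  then show ?thesis
    using AE_space
  proof eventually_elim
    case (elim x)
    then obtain j where j: "\<And>n. (\<Sum>k<n. Q k x) < real (Suc j)"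
      unfolding A_def by (auto simp: not_le)
    show ?case
      by (rule summableI_nonneg_bounded[where x = "real (Suc j)"]) (use nonneg j in \<open>auto intro: less_imp_le\<close>)
  qed
qed

subsection \<open>The mean gradient\<close>

text \<open>Continuity is required on the whole space and for every sample, without an exceptional
  null set, so that \<open>H\<close> is a Caratheodory function. The final proof modifies the given
  oracle to fit.\<close>

locale stochastic_gradient_oracle = prob_space M for M :: "'w measure" +
  fixes H :: "'a::euclidean_space \<Rightarrow> 'w \<Rightarrow> 'a" and V :: real
  assumes H_measurable [measurable]: "\<And>x. H x \<in> borel_measurable M"
    and H_continuous: "\<And>\<omega>. \<omega> \<in> space M \<Longrightarrow> continuous_on UNIV (\<lambda>x. H x \<omega>)"
    and H_square_integrable: "\<And>x. integrable M (\<lambda>\<omega>. (norm (H x \<omega>))\<^sup>2)"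
    and H_second_moment: "\<And>x. expectation (\<lambda>\<omega>. (norm (H x \<omega>))\<^sup>2) \<le> V\<^sup>2"
begin

definition mean_gradient :: "'a \<Rightarrow> 'a" where
  "mean_gradient x = expectation (H x)"

lemma H_jointly_measurable: "(\<lambda>(x, \<omega>). H x \<omega>) \<in> borel_measurable (borel \<Otimes>\<^sub>M M)"
  by (rule borel_measurable_caratheodory[OF H_measurable H_continuous])

lemma H_integrable: "integrable M (H x)"
  using H_measurable H_square_integrable by (rule square_integrable_norm_imp_integrable)

lemma mean_gradient_continuous: "continuous_on UNIV mean_gradient"
proof (intro continuous_at_imp_continuous_on ballI continuous_at_sequentiallyI)
  fix x :: 'a and u :: "nat \<Rightarrow> 'a" assume u: "u \<longlonglongrightarrow> x"
  have "AE \<omega> in M. (\<lambda>n. H (u n) \<omega>) \<longlonglongrightarrow> H x \<omega>"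
    by (intro AE_I2 continuous_on_tendsto_compose[OF H_continuous u]) auto
  then show "(\<lambda>n. mean_gradient (u n)) \<longlonglongrightarrow> mean_gradient x"
    unfolding mean_gradient_def
    by (intro tendsto_expectation_of_bounded_second_moment[where C = "V\<^sup>2"]
        H_measurable H_square_integrable H_second_moment)
qed

lemma mean_gradient_measurable [measurable]: "mean_gradient \<in> borel_measurable borel"
  using mean_gradient_continuous by (rule borel_measurable_continuous_onI)

text \<open>This is Jensen's inequality, obtained from the nonnegativity of the variance of the
  norm.\<close>

lemma norm_mean_gradient_le: "(norm (mean_gradient x))\<^sup>2 \<le> V\<^sup>2"
proof -
  have int: "integrable M (\<lambda>\<omega>. norm (H x \<omega>))"
    using H_integrable by simp
  have "norm (mean_gradient x) \<le> expectation (\<lambda>\<omega>. norm (H x \<omega>))"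
    unfolding mean_gradient_def by (rule integral_norm_bound)
  then have "(norm (mean_gradient x))\<^sup>2 \<le> (expectation (\<lambda>\<omega>. norm (H x \<omega>)))\<^sup>2"
    by (intro power_mono) auto
  also have "\<dots> \<le> expectation (\<lambda>\<omega>. (norm (H x \<omega>))\<^sup>2)"
    using variance_positive[of "\<lambda>\<omega>. norm (H x \<omega>)"] variance_eq[OF int H_square_integrable] by linarith
  also have "\<dots> \<le> V\<^sup>2"
    by (rule H_second_moment)
  finally show ?thesis .
qed

text \<open>The fundamental theorem of calculus is applied along the segment for almost every
  sample, and Fubini exchanges the two integrals. Only the mean gradient on the segment remains,
  without differentiating an expectation.\<close>

lemma expectation_increment_le:
  fixes \<Phi> :: "'a \<Rightarrow> 'w \<Rightarrow> real"
  assumes int: "integrable M (\<Phi> a)" "integrable M (\<Phi> b)"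
    and deriv: "AE \<omega> in M. \<forall>s\<in>{0..1}. ((\<lambda>s. \<Phi> (a + s *\<^sub>R (b - a)) \<omega>) has_vector_derivative
      H (a + s *\<^sub>R (b - a)) \<omega> \<bullet> (b - a)) (at s within {0..1})"
    and K: "\<And>s. s \<in> {0..1} \<Longrightarrow> mean_gradient (a + s *\<^sub>R (b - a)) \<bullet> (b - a) \<le> K"
  shows "expectation (\<Phi> b) - expectation (\<Phi> a) \<le> K"
proof -
  interpret P: pair_sigma_finite lborel M ..
  define p where "p s \<omega> = indicator {0..1} s * (H (a + s *\<^sub>R (b - a)) \<omega> \<bullet> (b - a))" for s :: real and \<omega>
  have H_seg: "(\<lambda>z. H (a + fst z *\<^sub>R (b - a)) (snd z)) \<in> borel_measurable (lborel \<Otimes>\<^sub>M M)"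
    using measurable_compose[OF _ H_jointly_measurable, of "\<lambda>z. (a + fst z *\<^sub>R (b - a), snd z)" "lborel \<Otimes>\<^sub>M M"]
    by simp
  have p_meas: "case_prod p \<in> borel_measurable (lborel \<Otimes>\<^sub>M M)"
    unfolding p_def split_beta'
    by (intro borel_measurable_times borel_measurable_inner H_seg) measurable
  have int_s: "integrable M (p s)" for s
    unfolding p_def by (intro integrable_mult_right integrable_inner_left H_integrable)
  \<comment> \<open>Bounding the norm by one plus its square lets the second-moment bound dominate
    the integrand in Fubini's theorem.\<close>
  have inner_le: "\<bar>v \<bullet> (b - a)\<bar> \<le> (1 + (norm v)\<^sup>2) * norm (b - a)" for v
  proof -
    have "2 * norm v \<le> 1 + (norm v)\<^sup>2"
      using sum_squares_bound[of 1 "norm v"] by simp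
    then have "norm v \<le> 1 + (norm v)\<^sup>2"
      using norm_ge_zero[of v] by linarith
    then have "norm v * norm (b - a) \<le> (1 + (norm v)\<^sup>2) * norm (b - a)"
      by (rule mult_right_mono) simp
    with Cauchy_Schwarz_ineq2[of v "b - a"] show ?thesis
      by linarith
  qed
  have p_int: "integrable (lborel \<Otimes>\<^sub>M M) (case_prod p)"
  proof (rule P.Fubini_integrable[OF p_meas])
    show "integrable lborel (\<lambda>s. \<integral>\<omega>. norm (case_prod p (s, \<omega>)) \<partial>M)"
    proof (rule Bochner_Integration.integrable_bound)
      show "integrable lborel (\<lambda>s::real. indicator {0..1} s * ((1 + V\<^sup>2) * norm (b - a)))"
        by (intro integrable_mult_left integrable_real_indicator) auto
      show "(\<lambda>s. \<integral>\<omega>. norm (case_prod p (s, \<omega>)) \<partial>M) \<in> borel_measurable lborel"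
        using p_meas by (intro borel_measurable_lebesgue_integral borel_measurable_norm) (simp add: split_beta')
      have "(\<integral>\<omega>. norm (p s \<omega>) \<partial>M) \<le> indicator {0..1} s * ((1 + V\<^sup>2) * norm (b - a))" for s
      proof -
        have "(\<integral>\<omega>. norm (p s \<omega>) \<partial>M) \<le> (\<integral>\<omega>. indicator {0..1} s * ((1 + (norm (H (a + s *\<^sub>R (b - a)) \<omega>))\<^sup>2) * norm (b - a)) \<partial>M)"
        proof (rule integral_mono)
          show "norm (p s \<omega>) \<le> indicator {0..1} s * ((1 + (norm (H (a + s *\<^sub>R (b - a)) \<omega>))\<^sup>2) * norm (b - a))" for \<omega>
            using inner_le by (simp add: p_def abs_mult indicator_def)
        qed (use int_s H_square_integrable in auto)
        also have "\<dots> = indicator {0..1} s * ((1 + expectation (\<lambda>\<omega>. (norm (H (a + s *\<^sub>R (b - a)) \<omega>))\<^sup>2)) * norm (b - a))"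
          using H_square_integrable by (simp add: prob_space)
        also have "\<dots> \<le> indicator {0..1} s * ((1 + V\<^sup>2) * norm (b - a))"
          using H_second_moment by (intro mult_left_mono mult_right_mono add_left_mono) auto
        finally show ?thesis .
      qed
      then show "AE s in lborel. norm (\<integral>\<omega>. norm (case_prod p (s, \<omega>)) \<partial>M)
          \<le> norm (indicator {0..1} s * ((1 + V\<^sup>2) * norm (b - a)))"
        by (intro AE_I2) (simp add: abs_mult)
    qed
  qed (use int_s in auto)
  have "expectation (\<Phi> b) - expectation (\<Phi> a) = expectation (\<lambda>\<omega>. \<Phi> b \<omega> - \<Phi> a \<omega>)"
    using int by simp
  also have "\<dots> = expectation (\<lambda>\<omega>. \<integral>s. p s \<omega> \<partial>lborel)"
  proof (rule integral_cong_AE)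
    show "(\<lambda>\<omega>. \<integral>s. p s \<omega> \<partial>lborel) \<in> borel_measurable M"
      by (rule borel_measurable_integrable[OF P.integrable_snd[OF p_int]])
    show "AE \<omega> in M. \<Phi> b \<omega> - \<Phi> a \<omega> = (\<integral>s. p s \<omega> \<partial>lborel)"
      using deriv AE_space
    proof eventually_elim
      case (elim \<omega>)
      have "continuous_on {0..1} (\<lambda>s. H (a + s *\<^sub>R (b - a)) \<omega> \<bullet> (b - a))"
        by (intro continuous_intros continuous_on_compose2[OF H_continuous[OF elim(2)]]) auto
      from integral_FTC_Icc[OF zero_le_one _ this, of "\<lambda>s. \<Phi> (a + s *\<^sub>R (b - a)) \<omega>"] elim(1)
      show ?case
        by (simp add: p_def)
    qed
  qed (use int in auto)
  also have "\<dots> = (\<integral>s. expectation (p s) \<partial>lborel)"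
    using P.Fubini_integral[OF p_int] .
  also have "\<dots> \<le> (\<integral>s. indicator {0..(1::real)} s * K \<partial>lborel)"
  proof (rule integral_mono)
    show "integrable lborel (\<lambda>s. expectation (p s))"
      using P.integrable_fst[OF p_int] .
    show "integrable lborel (\<lambda>s::real. indicator {0..1} s * K)"
      by (intro integrable_mult_left integrable_real_indicator) auto
    show "expectation (p s) \<le> indicator {0..1} s * K" for s
      using K[of s] H_integrable by (simp add: p_def[abs_def] mean_gradient_def indicator_def)
  qed
  also have "\<dots> = K"
    by simp
  finally show ?thesis .
qed

text \<open>Strict concavity makes the difference quotients of \<open>f\<close> from \<open>p\<close> towards \<open>x\<close> bounded below by
  some \<open>\<kappa> > 0\<close>; continuity of the mean gradient transfers this bound to the slope at \<open>p\<close>.\<close>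

lemma mean_gradient_pos_at_local_minimum:
  fixes \<Phi> :: "'a \<Rightarrow> 'w \<Rightarrow> real"
  assumes int: "\<And>x. x \<in> X \<Longrightarrow> integrable M (\<Phi> x)"
    and f: "\<And>x. x \<in> X \<Longrightarrow> f x = expectation (\<Phi> x)"
    and deriv: "AE \<omega> in M. \<forall>x\<in>X. ((\<lambda>x. \<Phi> x \<omega>) has_derivative (\<lambda>v. H x \<omega> \<bullet> v)) (at x within X)"
    and concave: "strictly_concave_on X f" and min: "local_minimum_on X f p"
    and x: "x \<in> X" "x \<noteq> p"
  shows "0 < mean_gradient p \<bullet> (x - p)"
proof (rule ccontr)
  assume "\<not> ?thesis"
  then have neg: "mean_gradient p \<bullet> (x - p) \<le> 0" by simp
  have X: "convex X" using concave by (simp add: strictly_concave_on_def)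
  obtain N where N: "openin (top_of_set X) N" "p \<in> N" "\<And>y. y \<in> N \<Longrightarrow> f p \<le> f y"
    using min by (auto simp: local_minimum_on_def)
  then have p: "p \<in> X"
    using openin_subset by fastforce
  obtain r where r: "0 < r" "ball p r \<inter> X \<subseteq> N"
    using N(1,2) by (auto simp: openin_contains_ball)
  have seg: "p + s *\<^sub>R (x - p) \<in> X" if "0 \<le> s" "s \<le> 1" for s
  proof -
    have "(1 - s) *\<^sub>R p + s *\<^sub>R x \<in> X"
      using X p x that by (auto simp: convex_alt)
    then show ?thesis by (simp add: algebra_simps)
  qed
  define \<phi> where "\<phi> s = f (p + s *\<^sub>R (x - p))" for s
  have \<phi>_concave: "(1 - t) * f p + t * \<phi> s < \<phi> (t * s)" if "0 < s" "s \<le> 1" "0 < t" "t < 1" for s t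
  proof -
    have "p \<noteq> p + s *\<^sub>R (x - p)"
      using that x by simp
    moreover have "p + s *\<^sub>R (x - p) \<in> X"
      using seg that by simp
    moreover have "(1 - t) *\<^sub>R p + t *\<^sub>R (p + s *\<^sub>R (x - p)) = p + (t * s) *\<^sub>R (x - p)"
      by (simp add: algebra_simps)
    ultimately show ?thesis
      using concave p that unfolding strictly_concave_on_def \<phi>_def by metis
  qed
  \<comment> \<open>The point at parameter \<open>s0\<close> lies in the ball where \<open>p\<close>
    is minimal. Strict concavity then raises the value at the midpoint strictly above
    \<open>f p\<close>.\<close>
  define s0 where "s0 = min 1 (r / (2 * norm (x - p)))"
  have s0: "0 < s0" "s0 \<le> 1"
    using r x by (auto simp: s0_def)
  have "s0 * norm (x - p) \<le> r / (2 * norm (x - p)) * norm (x - p)"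
    by (intro mult_right_mono) (auto simp: s0_def)
  also have "\<dots> < r"
    using r x by simp
  finally have "p + s0 *\<^sub>R (x - p) \<in> ball p r"
    using s0 by (simp add: dist_norm)
  then have "f p \<le> \<phi> s0"
    unfolding \<phi>_def using r N(3) seg s0 by (meson IntI less_imp_le subsetD)
  with \<phi>_concave[of s0 "1/2"] s0 have half: "f p < \<phi> (s0 / 2)"
    by (simp add: field_simps)
  define s1 where "s1 = s0 / 2"
  define \<kappa> where "\<kappa> = \<phi> s1 - f p"
  have \<kappa>: "0 < \<kappa>" and s1: "0 < s1" "s1 \<le> 1"
    using half s0 by (simp_all add: \<kappa>_def s1_def)
  \<comment> \<open>If the slope at \<open>p\<close> were not positive, continuity would keep the
    slopes near \<open>p\<close>, scaled by \<open>s1\<close>, below \<open>\<kappa>\<close>.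
    Integrating them over a short segment bounds the increment of \<open>f\<close> by
    \<open>t * \<kappa>\<close>, while strict concavity makes it exceed
    \<open>t * \<kappa>\<close>.\<close>
  have "((\<lambda>t. mean_gradient (p + (t * s1) *\<^sub>R (x - p)) \<bullet> (s1 *\<^sub>R (x - p))) \<longlongrightarrow>
      mean_gradient (p + (0 * s1) *\<^sub>R (x - p)) \<bullet> (s1 *\<^sub>R (x - p))) (at_right 0)"
    by (intro tendsto_intros continuous_on_tendsto_compose[OF mean_gradient_continuous]) auto
  moreover have "mean_gradient (p + (0 * s1) *\<^sub>R (x - p)) \<bullet> (s1 *\<^sub>R (x - p)) < \<kappa>"
    using neg s1 \<kappa> mult_nonneg_nonpos[of s1 "mean_gradient p \<bullet> (x - p)"] by simp
  ultimately have "eventually (\<lambda>t. mean_gradient (p + (t * s1) *\<^sub>R (x - p)) \<bullet> (s1 *\<^sub>R (x - p)) < \<kappa>) (at_right 0)"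
    by (rule order_tendstoD)
  then obtain u where u: "0 < u" "\<And>t. 0 < t \<Longrightarrow> t < u \<Longrightarrow> mean_gradient (p + (t * s1) *\<^sub>R (x - p)) \<bullet> (s1 *\<^sub>R (x - p)) < \<kappa>"
    unfolding eventually_at_right_field by blast
  define t where "t = min (1/2) (u / 2)"
  have t: "0 < t" "t < 1" "t < u"
    using u by (auto simp: t_def)
  define b where "b = p + (t * s1) *\<^sub>R (x - p)"
  have ts1: "0 \<le> t * s1" "t * s1 \<le> 1"
    using t s1 by (auto intro: mult_le_one)
  then have b: "b \<in> X"
    unfolding b_def by (rule seg)
  have seg_b: "p + s *\<^sub>R (b - p) \<in> X" if "s \<in> {0..1}" for s
  proof -
    have "(1 - s) *\<^sub>R p + s *\<^sub>R b \<in> X"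
      using X p b that by (auto simp: convex_alt)
    then show ?thesis by (simp add: algebra_simps)
  qed
  have "expectation (\<Phi> b) - expectation (\<Phi> p) \<le> t * \<kappa>"
  proof (rule expectation_increment_le[where \<Phi> = \<Phi> and a = p and b = b])
    show "AE \<omega> in M. \<forall>s\<in>{0..1}. ((\<lambda>s. \<Phi> (p + s *\<^sub>R (b - p)) \<omega>) has_vector_derivative
        H (p + s *\<^sub>R (b - p)) \<omega> \<bullet> (b - p)) (at s within {0..1})"
      using deriv
    proof eventually_elim
      case (elim \<omega>)
      show ?case
      proof
        fix s :: real assume s: "s \<in> {0..1}"
        have outer: "((\<lambda>x. \<Phi> x \<omega>) has_derivative (\<lambda>v. H (p + s *\<^sub>R (b - p)) \<omega> \<bullet> v))
            (at (p + s *\<^sub>R (b - p)) within (\<lambda>s. p + s *\<^sub>R (b - p)) ` {0..1})"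
        proof (rule has_derivative_subset)
          show "((\<lambda>x. \<Phi> x \<omega>) has_derivative (\<lambda>v. H (p + s *\<^sub>R (b - p)) \<omega> \<bullet> v)) (at (p + s *\<^sub>R (b - p)) within X)"
            using elim seg_b[OF s] by blast
          show "(\<lambda>s. p + s *\<^sub>R (b - p)) ` {0..1} \<subseteq> X"
            using seg_b by blast
        qed
        have inner: "((\<lambda>s. p + s *\<^sub>R (b - p)) has_derivative (\<lambda>h. h *\<^sub>R (b - p))) (at s within {0..1})"
          by (auto intro!: derivative_eq_intros)
        show "((\<lambda>s. \<Phi> (p + s *\<^sub>R (b - p)) \<omega>) has_vector_derivative
            H (p + s *\<^sub>R (b - p)) \<omega> \<bullet> (b - p)) (at s within {0..1})"
          using has_derivative_in_compose[OF inner outer]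
          by (simp add: has_vector_derivative_def)
      qed
    qed
  next
    fix s :: real assume s: "s \<in> {0..1}"
    have e: "p + s *\<^sub>R (b - p) = p + (s * t * s1) *\<^sub>R (x - p)" "b - p = t *\<^sub>R (s1 *\<^sub>R (x - p))"
      by (simp_all add: b_def algebra_simps)
    have "mean_gradient (p + (s * t * s1) *\<^sub>R (x - p)) \<bullet> (s1 *\<^sub>R (x - p)) \<le> \<kappa>"
    proof (cases "s = 0")
      case True
      then show ?thesis
        using neg s1 \<kappa> mult_nonneg_nonpos[of s1 "mean_gradient p \<bullet> (x - p)"] by simp
    next
      case False
      then have "0 < s * t"
        using s t by simp
      moreover have "s * t < u"
      proof -
        have "s * t \<le> t"
          using s t by (intro mult_left_le_one_le) auto
        then show ?thesis
          using t(3) by (rule le_less_trans)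
      qed
      ultimately show ?thesis
        using u(2)[of "s * t"] by simp
    qed
    then have "t * (mean_gradient (p + (s * t * s1) *\<^sub>R (x - p)) \<bullet> (s1 *\<^sub>R (x - p))) \<le> t * \<kappa>"
      using t by (intro mult_left_mono) auto
    then show "mean_gradient (p + s *\<^sub>R (b - p)) \<bullet> (b - p) \<le> t * \<kappa>"
      unfolding e by (simp add: mult.assoc)
  qed (use int p b in auto)
  then have "\<phi> (t * s1) - f p \<le> t * \<kappa>"
    using f p b by (simp add: \<phi>_def b_def)
  moreover have "t * \<kappa> < \<phi> (t * s1) - f p"
    using \<phi>_concave[of s1 t] s1 t by (simp add: \<kappa>_def algebra_simps)
  ultimately show False
    by simp
qed

end

subsection \<open>The lazy stochastic gradient process\<close>

lemma sets_subset_of_measurable_ident: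
  assumes "(\<lambda>x. x) \<in> M \<rightarrow>\<^sub>M N" and "space N = space M"
  shows "sets N \<subseteq> sets M"
proof
  fix A assume "A \<in> sets N"
  with measurable_sets[OF assms(1) this] show "A \<in> sets M"
    using sets.sets_into_space[of A N] assms(2) by (simp add: Int_absorb2)
qed

locale lazy_sgd_process = stochastic_gradient_oracle M H V + S: prob_space S
  for M :: "'w measure" and H :: "'a::euclidean_space \<Rightarrow> 'w \<Rightarrow> 'a" and V and S :: "'s measure" +
  fixes X :: "'a set" and \<omega> :: "nat \<Rightarrow> 's \<Rightarrow> 'w" and \<gamma> :: "nat \<Rightarrow> real" and y p :: 'a
  assumes X: "compact X" "convex X" and p: "p \<in> X"
    and iid: "iid_samples S M \<omega>" and steps: "admissible_steps \<gamma>"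
begin

definition score :: "nat \<Rightarrow> 's \<Rightarrow> 'a" where
  "score n s = lazy_sgd_score X H \<gamma> y (\<lambda>k. \<omega> k s) n"

definition iterate :: "nat \<Rightarrow> 's \<Rightarrow> 'a" where
  "iterate n s = closest_point X (score n s)"

definition gradient :: "nat \<Rightarrow> 's \<Rightarrow> 'a" where
  "gradient n s = H (iterate n s) (\<omega> n s)"

definition noise :: "nat \<Rightarrow> 's \<Rightarrow> real" where
  "noise n s = \<gamma> n * ((gradient n s - mean_gradient (iterate n s)) \<bullet> (iterate n s - p))"

definition drift :: "nat \<Rightarrow> 's \<Rightarrow> real" where
  "drift n s = (\<gamma> n)\<^sup>2 * (norm (gradient n s))\<^sup>2 / 2"

definition history :: "nat \<Rightarrow> 's \<Rightarrow> nat \<Rightarrow> 'w" where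
  "history n s = restrict (\<lambda>k. \<omega> k s) {..<n}"

text \<open>Time \<open>n\<close> knows the samples with index below \<open>n\<close>: enough to
  determine the iterate at which the \<open>n\<close>-th gradient is taken, but not the sample
  \<open>\<omega> n\<close> used there.\<close>

definition filtration :: "nat \<Rightarrow> 's measure" where
  "filtration n = vimage_algebra (space S) (history n) (PiM {..<n} (\<lambda>_. M))"

lemma score_0: "score 0 s = y" and score_Suc: "score (Suc n) s = score n s - \<gamma> n *\<^sub>R gradient n s"
  by (simp_all add: score_def gradient_def iterate_def)

lemma X_nonempty: "X \<noteq> {}" and X_closed: "closed X"
  using p X by (auto intro: compact_imp_closed)

lemma iterate_in: "iterate n s \<in> X"
  unfolding iterate_def by (rule closest_point_in_set[OF X_closed X_nonempty])

lemma sample_measurable [measurable]: "\<omega> n \<in> S \<rightarrow>\<^sub>M M"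
  using iid by (simp add: iid_samples_def S.indep_vars_def)

lemma distr_sample: "distr S M (\<omega> n) = M"
  using iid by (simp add: iid_samples_def)

lemma history_measurable: "history n \<in> S \<rightarrow>\<^sub>M PiM {..<n} (\<lambda>_. M)"
  unfolding history_def by (intro measurable_restrict sample_measurable)

lemma space_filtration [simp]: "space (filtration n) = space S"
  by (simp add: filtration_def)

lemma subalgebra_filtration: "subalgebra S (filtration n)"
proof -
  have "(\<lambda>s. s) \<in> S \<rightarrow>\<^sub>M filtration n"
    unfolding filtration_def using history_measurable
    by (intro measurable_vimage_algebra2) (auto simp: measurable_def)
  then show ?thesis
    by (simp add: subalgebra_def sets_subset_of_measurable_ident)
qed

lemma sample_filtration: "k < n \<Longrightarrow> \<omega> k \<in> filtration n \<rightarrow>\<^sub>M M"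
proof -
  assume k: "k < n"
  have "history n \<in> filtration n \<rightarrow>\<^sub>M PiM {..<n} (\<lambda>_. M)"
    unfolding filtration_def using history_measurable[of n]
    by (intro measurable_vimage_algebra1) (auto simp: measurable_def)
  from measurable_compose[OF this measurable_component_singleton[of k "{..<n}"]]
  have "(\<lambda>s. history n s k) \<in> filtration n \<rightarrow>\<^sub>M M"
    using k by simp
  then show "\<omega> k \<in> filtration n \<rightarrow>\<^sub>M M"
    using k by (simp add: history_def)
qed

lemma filtration_mono:
  assumes "m \<le> n"
  shows "sets (filtration m) \<subseteq> sets (filtration n)"
proof -
  have "history m \<in> filtration n \<rightarrow>\<^sub>M PiM {..<m} (\<lambda>_. M)"
    unfolding history_def using assms by (intro measurable_restrict sample_filtration) auto
  then have "(\<lambda>s. s) \<in> filtration n \<rightarrow>\<^sub>M filtration m"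
    using measurable_space[OF history_measurable[of m]] unfolding filtration_def[of m]
    by (intro measurable_vimage_algebra2) auto
  then show ?thesis
    by (simp add: sets_subset_of_measurable_ident)
qed

text \<open>The index blocks \<open>{..<n}\<close> and \<open>{n}\<close> are disjoint, so the
  corresponding families of samples are independent. What remains is to rewrite an event of the
  single sample as a cylinder over \<open>{n}\<close>.\<close>

lemma indep_filtration_sample:
  "S.indep_set (sets (filtration n)) {\<omega> n -` A \<inter> space S | A. A \<in> sets M}"
proof -
  let ?single = "\<lambda>s. restrict (\<lambda>k. \<omega> k s) {n}"
  have "S.indep_vars (\<lambda>_. M) \<omega> UNIV"
    using iid by (simp add: iid_samples_def)
  then have "S.indep_var (PiM {..<n} (\<lambda>_. M)) (\<lambda>s. restrict (\<lambda>k. \<omega> k s) {..<n}) (PiM {n} (\<lambda>_. M)) ?single"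
    by (rule S.indep_var_restrict) auto
  then have ind: "S.indep_set (sets (filtration n))
      (sigma_sets (space S) {?single -` A \<inter> space S | A. A \<in> sets (PiM {n} (\<lambda>_. M))})"
    unfolding S.indep_var_eq filtration_def sets_vimage_algebra history_def[abs_def] by blast
  show ?thesis
  proof (rule S.indep_setI)
    show "sets (filtration n) \<subseteq> S.events"
      using subalgebra_filtration by (simp add: subalgebra_def)
    show "{\<omega> n -` A \<inter> space S |A. A \<in> sets M} \<subseteq> S.events"
      using measurable_sets[OF sample_measurable] by blast
    fix A B assume A: "A \<in> sets (filtration n)" and "B \<in> {\<omega> n -` A \<inter> space S |A. A \<in> sets M}"
    then obtain B' where B': "B' \<in> sets M" "B = \<omega> n -` B' \<inter> space S"
      by blast
    define C where "C = (\<lambda>h. h n) -` B' \<inter> space (PiM {n} (\<lambda>_. M))"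
    have "C \<in> sets (PiM {n} (\<lambda>_. M))"
      unfolding C_def using B'(1) by (intro measurable_sets[OF measurable_component_singleton]) auto
    moreover have "B = ?single -` C \<inter> space S"
      using measurable_space[OF sample_measurable[of n]] by (auto simp: C_def B'(2) space_PiM)
    ultimately have "B \<in> sigma_sets (space S) {?single -` A \<inter> space S | A. A \<in> sets (PiM {n} (\<lambda>_. M))}"
      by blast
    then show "S.prob (A \<inter> B) = S.prob A * S.prob B"
      using ind A by (intro S.indep_setD)
  qed
qed

lemma closest_point_measurable: "closest_point X \<in> borel_measurable borel"
  using X X_closed X_nonempty by (intro borel_measurable_continuous_onI continuous_on_closest_point)

text \<open>The gradient is evaluated at a random point, so the induction needs the joint
  measurability of \<open>H\<close>.\<close>

lemma score_adapted: "score n \<in> borel_measurable (filtration n)"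
proof (induction n)
  case 0
  then show ?case
    by (simp add: score_0[abs_def])
next
  case (Suc n)
  have sub: "subalgebra (filtration (Suc n)) (filtration n)"
    using filtration_mono[of n "Suc n"] by (simp add: subalgebra_def)
  note sc = measurable_from_subalg[OF sub Suc]
  have it: "iterate n \<in> borel_measurable (filtration (Suc n))"
    unfolding iterate_def[abs_def] using measurable_compose[OF sc closest_point_measurable] .
  have "gradient n \<in> borel_measurable (filtration (Suc n))"
    unfolding gradient_def[abs_def]
    using measurable_compose[OF measurable_Pair[OF it sample_filtration[of n "Suc n"]] H_jointly_measurable]
    by simp
  then show ?case
    unfolding score_Suc[abs_def] using sc by measurable
qed

lemma iterate_adapted: "iterate n \<in> borel_measurable (filtration n)"
  unfolding iterate_def[abs_def] using measurable_compose[OF score_adapted closest_point_measurable] .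

lemma iterate_measurable [measurable]: "iterate n \<in> borel_measurable S"
  using measurable_from_subalg[OF subalgebra_filtration iterate_adapted] .

lemma H_iterate_measurable:
  "(\<lambda>z. H (iterate n (fst z)) (snd z)) \<in> borel_measurable (filtration n \<Otimes>\<^sub>M M)"
  using measurable_compose[OF measurable_Pair[OF measurable_compose[OF measurable_fst iterate_adapted] measurable_snd]
      H_jointly_measurable]
  by simp

lemma gradient_adapted: "gradient n \<in> borel_measurable (filtration (Suc n))"
proof -
  have "subalgebra (filtration (Suc n)) (filtration n)"
    using filtration_mono[of n "Suc n"] by (simp add: subalgebra_def)
  from measurable_from_subalg[OF this iterate_adapted] show ?thesis
    unfolding gradient_def[abs_def]
    using measurable_compose[OF measurable_Pair[OF _ sample_filtration[of n "Suc n"]] H_jointly_measurable]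
    by simp
qed

lemma gradient_measurable [measurable]: "gradient n \<in> borel_measurable S"
  using measurable_from_subalg[OF subalgebra_filtration gradient_adapted] .

text \<open>With the past frozen the iterate is a fixed point, where the second-moment bound of the
  oracle applies. Working with nonnegative integrals first yields integrability and the bound
  together.\<close>

lemma gradient_square_integrable: "integrable S (\<lambda>s. (norm (gradient n s))\<^sup>2)"
  and gradient_second_moment: "S.expectation (\<lambda>s. (norm (gradient n s))\<^sup>2) \<le> V\<^sup>2"
proof -
  define h where "h z = ennreal ((norm (H (iterate n (fst z)) (snd z)))\<^sup>2)" for z
  have h: "h \<in> borel_measurable (filtration n \<Otimes>\<^sub>M M)"
    unfolding h_def[abs_def] using H_iterate_measurable by measurable
  have "(\<integral>\<^sup>+s. ennreal ((norm (gradient n s))\<^sup>2) \<partial>S) = (\<integral>\<^sup>+s. \<integral>\<^sup>+w. h (s, w) \<partial>M \<partial>S)"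
    using S.nn_integral_indep_pair[OF subalgebra_filtration sample_measurable indep_filtration_sample h]
    by (simp add: h_def gradient_def distr_sample)
  also have "\<dots> \<le> (\<integral>\<^sup>+s. ennreal (V\<^sup>2) \<partial>S)"
  proof (rule nn_integral_mono)
    fix s
    have "(\<integral>\<^sup>+w. h (s, w) \<partial>M) = ennreal (expectation (\<lambda>w. (norm (H (iterate n s) w))\<^sup>2))"
      unfolding h_def fst_conv snd_conv by (rule nn_integral_eq_integral[OF H_square_integrable]) simp
    also have "\<dots> \<le> ennreal (V\<^sup>2)"
      using H_second_moment by (rule ennreal_leI)
    finally show "(\<integral>\<^sup>+w. h (s, w) \<partial>M) \<le> ennreal (V\<^sup>2)" .
  qed
  also have "\<dots> = ennreal (V\<^sup>2)"
    by (simp add: S.emeasure_space_1)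
  finally have le: "(\<integral>\<^sup>+s. ennreal ((norm (gradient n s))\<^sup>2) \<partial>S) \<le> ennreal (V\<^sup>2)" .
  show int: "integrable S (\<lambda>s. (norm (gradient n s))\<^sup>2)"
    using le by (intro integrableI_bounded) (auto simp: top_unique less_top intro: le_less_trans)
  show "S.expectation (\<lambda>s. (norm (gradient n s))\<^sup>2) \<le> V\<^sup>2"
    using le nn_integral_eq_integral[OF int] by simp
qed

lemma noise_adapted: "noise n \<in> borel_measurable (filtration (Suc n))"
proof -
  have "subalgebra (filtration (Suc n)) (filtration n)"
    using filtration_mono[of n "Suc n"] by (simp add: subalgebra_def)
  note [measurable] = measurable_from_subalg[OF this iterate_adapted] gradient_adapted
  show ?thesis
    unfolding noise_def[abs_def] by measurable
qed

lemma noise_measurable [measurable]: "noise n \<in> borel_measurable S"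
  using measurable_from_subalg[OF subalgebra_filtration noise_adapted] .

text \<open>Since \<open>X\<close> is compact, the noise has bounded second moments along the whole trajectory,
  so no stopping time is needed.\<close>

lemma noise_square_le:
  "(noise n s)\<^sup>2 \<le> (\<gamma> n)\<^sup>2 * ((2 * (norm (gradient n s))\<^sup>2 + 2 * V\<^sup>2) * (diameter X)\<^sup>2)"
proof -
  let ?u = "gradient n s" and ?g = "mean_gradient (iterate n s)" and ?v = "iterate n s - p"
  have "(norm (?u - ?g))\<^sup>2 \<le> (norm ?u + norm ?g)\<^sup>2"
    by (intro power_mono norm_triangle_ineq4) auto
  also have "\<dots> \<le> 2 * (norm ?u)\<^sup>2 + 2 * (norm ?g)\<^sup>2"
    using sum_squares_bound[of "norm ?u" "norm ?g"] by (simp add: power2_sum)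
  also have "\<dots> \<le> 2 * (norm ?u)\<^sup>2 + 2 * V\<^sup>2"
    using norm_mean_gradient_le[of "iterate n s"] by simp
  finally have 1: "(norm (?u - ?g))\<^sup>2 \<le> 2 * (norm ?u)\<^sup>2 + 2 * V\<^sup>2" .
  have 2: "(norm ?v)\<^sup>2 \<le> (diameter X)\<^sup>2"
    using diameter_bounded_bound[OF compact_imp_bounded[OF X(1)] iterate_in p] by (simp add: dist_norm power_mono)
  have "((?u - ?g) \<bullet> ?v)\<^sup>2 \<le> (norm (?u - ?g) * norm ?v)\<^sup>2"
    by (rule abs_le_square_iff[THEN iffD1]) (simp add: Cauchy_Schwarz_ineq2)
  also have "\<dots> \<le> (2 * (norm ?u)\<^sup>2 + 2 * V\<^sup>2) * (diameter X)\<^sup>2"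
    unfolding power_mult_distrib using 1 2 by (intro mult_mono) auto
  finally show ?thesis
    by (simp add: noise_def power_mult_distrib mult_left_mono)
qed

lemma noise_square_integrable: "integrable S (\<lambda>s. (noise n s)\<^sup>2)"
  and noise_second_moment: "S.expectation (\<lambda>s. (noise n s)\<^sup>2) \<le> (\<gamma> n)\<^sup>2 * (4 * V\<^sup>2 * (diameter X)\<^sup>2)"
proof -
  have int: "integrable S (\<lambda>s. (\<gamma> n)\<^sup>2 * ((2 * (norm (gradient n s))\<^sup>2 + 2 * V\<^sup>2) * (diameter X)\<^sup>2))"
    using gradient_square_integrable by auto
  show sq: "integrable S (\<lambda>s. (noise n s)\<^sup>2)"
    by (rule Bochner_Integration.integrable_bound[OF int]) (use noise_square_le in \<open>auto intro!: AE_I2\<close>)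
  have "S.expectation (\<lambda>s. (noise n s)\<^sup>2)
      \<le> S.expectation (\<lambda>s. (\<gamma> n)\<^sup>2 * ((2 * (norm (gradient n s))\<^sup>2 + 2 * V\<^sup>2) * (diameter X)\<^sup>2))"
    using sq int noise_square_le by (rule integral_mono)
  also have "\<dots> = (\<gamma> n)\<^sup>2 * ((2 * S.expectation (\<lambda>s. (norm (gradient n s))\<^sup>2) + 2 * V\<^sup>2) * (diameter X)\<^sup>2)"
    using gradient_square_integrable by (simp add: S.prob_space)
  also have "\<dots> \<le> (\<gamma> n)\<^sup>2 * ((2 * V\<^sup>2 + 2 * V\<^sup>2) * (diameter X)\<^sup>2)"
    using gradient_second_moment by (intro mult_left_mono mult_right_mono add_right_mono) auto
  finally show "S.expectation (\<lambda>s. (noise n s)\<^sup>2) \<le> (\<gamma> n)\<^sup>2 * (4 * V\<^sup>2 * (diameter X)\<^sup>2)"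
    by simp
qed

text \<open>Once the past is frozen, the only random factor is the gradient minus its mean, which
  integrates to zero over the fresh sample.\<close>

lemma noise_orthogonal:
  assumes Z: "Z \<in> borel_measurable (filtration n)" and Z2: "integrable S (\<lambda>s. (Z s)\<^sup>2)"
  shows "S.expectation (\<lambda>s. Z s * noise n s) = 0"
proof -
  define h where "h z = Z (fst z) * (\<gamma> n * ((H (iterate n (fst z)) (snd z) - mean_gradient (iterate n (fst z)))
    \<bullet> (iterate n (fst z) - p)))" for z
  have h: "h \<in> borel_measurable (filtration n \<Otimes>\<^sub>M M)"
  proof -
    note [measurable] = H_iterate_measurable[of n] iterate_adapted[of n] Z
    show ?thesis
      unfolding h_def[abs_def] by measurable
  qed
  have h_eq: "h (s, \<omega> n s) = Z s * noise n s" for s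
    by (simp add: h_def noise_def gradient_def)
  have "integrable S (\<lambda>s. Z s * noise n s)"
    using measurable_from_subalg[OF subalgebra_filtration Z] noise_measurable Z2 noise_square_integrable
    by (rule S.integrable_mult_square_integrable)
  then have "S.expectation (\<lambda>s. Z s * noise n s) = S.expectation (\<lambda>s. \<integral>w. h (s, w) \<partial>M)"
    using S.expectation_indep_pair[OF subalgebra_filtration sample_measurable indep_filtration_sample h]
    by (simp add: h_eq distr_sample)
  moreover have "(\<integral>w. h (s, w) \<partial>M) = 0" for s
    using H_integrable[of "iterate n s"] by (simp add: h_def mean_gradient_def prob_space)
  ultimately show ?thesis by simp
qed

sublocale N: square_integrable_martingale_differences S filtration noise
  by unfold_locales
    (use subalgebra_filtration filtration_mono noise_adapted noise_square_integrable noise_orthogonal in auto)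

lemma drift_nonneg: "0 \<le> drift n s"
  by (simp add: drift_def)

lemma drift_integrable: "integrable S (drift n)"
  and drift_expectation: "S.expectation (drift n) \<le> (\<gamma> n)\<^sup>2 * (V\<^sup>2 / 2)"
proof -
  show "integrable S (drift n)"
    unfolding drift_def[abs_def] using gradient_square_integrable by auto
  have "S.expectation (drift n) = (\<gamma> n)\<^sup>2 * (S.expectation (\<lambda>s. (norm (gradient n s))\<^sup>2) / 2)"
    unfolding drift_def[abs_def] by simp
  also have "\<dots> \<le> (\<gamma> n)\<^sup>2 * (V\<^sup>2 / 2)"
    using gradient_second_moment by (intro mult_left_mono divide_right_mono) auto
  finally show "S.expectation (drift n) \<le> (\<gamma> n)\<^sup>2 * (V\<^sup>2 / 2)" .
qed

lemma steps_pos: "0 < \<gamma> n" and steps_square_summable: "summable (\<lambda>n. (\<gamma> n)\<^sup>2)"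
  and steps_diverge: "filterlim (\<lambda>n. \<Sum>k<n. \<gamma> k) at_top sequentially"
  using steps by (auto simp: admissible_steps_def)

lemma noise_second_moment_summable: "summable (\<lambda>n. S.expectation (\<lambda>s. (noise n s)\<^sup>2))"
  by (rule summable_comparison_test_ev[OF always_eventually summable_mult2[OF steps_square_summable]])
    (use noise_second_moment in auto)

lemma noise_second_moment_suminf:
  "(\<Sum>n. S.expectation (\<lambda>s. (noise n s)\<^sup>2)) \<le> (\<Sum>n. (\<gamma> n)\<^sup>2) * (4 * V\<^sup>2 * (diameter X)\<^sup>2)"
  unfolding suminf_mult2[OF steps_square_summable]
  using noise_second_moment noise_second_moment_summable summable_mult2[OF steps_square_summable]
  by (rule suminf_le)

lemma drift_expectation_sum: "(\<Sum>k<n. S.expectation (drift k)) \<le> (\<Sum>n. (\<gamma> n)\<^sup>2) * (V\<^sup>2 / 2)"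
proof -
  have "(\<Sum>k<n. S.expectation (drift k)) \<le> (\<Sum>k<n. (\<gamma> k)\<^sup>2) * (V\<^sup>2 / 2)"
    unfolding sum_distrib_right using drift_expectation by (rule sum_mono)
  also have "\<dots> \<le> (\<Sum>n. (\<gamma> n)\<^sup>2) * (V\<^sup>2 / 2)"
    using steps_square_summable by (intro mult_right_mono sum_le_suminf) auto
  finally show ?thesis .
qed

section \<open>Confinement and convergence along a path\<close>

lemma energy_step:
  "energy X p (score (Suc n) s) \<le> energy X p (score n s)
    - \<gamma> n * (mean_gradient (iterate n s) \<bullet> (iterate n s - p)) - noise n s + drift n s"
proof -
  have "energy X p (score (Suc n) s) \<le> energy X p (score n s)
      - (\<gamma> n *\<^sub>R gradient n s) \<bullet> (iterate n s - p) + (norm (\<gamma> n *\<^sub>R gradient n s))\<^sup>2 / 2"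
    unfolding score_Suc iterate_def using X_closed X(2) X_nonempty by (rule energy_descent)
  then show ?thesis
    by (simp add: noise_def drift_def power_mult_distrib algebra_simps)
qed

text \<open>The induction is self-supporting: the energy bound at time \<open>n\<close> puts the
  iterate within \<open>\<rho>\<close> of \<open>p\<close>, there the mean gradient does not raise
  the energy, and so the bound passes to time \<open>n + 1\<close>.\<close>

lemma iterates_near:
  assumes \<rho>: "0 < \<rho>"
    and near: "\<And>x. x \<in> X \<Longrightarrow> norm (x - p) < \<rho> \<Longrightarrow> 2 *\<^sub>R x - p \<in> X \<and> 0 \<le> mean_gradient x \<bullet> (x - p)"
    and start: "norm (closest_point X y - p) < \<rho> / 2"
    and noise: "\<And>n. \<bar>\<Sum>k<n. noise k s\<bar> < \<rho>\<^sup>2 / 8" and drift: "\<And>n. (\<Sum>k<n. drift k s) < \<rho>\<^sup>2 / 8"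
  shows "norm (iterate n s - p) < \<rho>"
proof -
  \<comment> \<open>The reflection property turns the initial energy into half the squared distance
    of the projection, whatever the distance of \<open>y\<close> to \<open>X\<close>; the radius
    \<open>\<rho> / 2\<close> gives the bound.\<close>
  have e0: "energy X p (score 0 s) \<le> \<rho>\<^sup>2 / 8"
  proof -
    have "closest_point X y \<in> X"
      by (rule closest_point_in_set[OF X_closed X_nonempty])
    then have "energy X p y = (norm (closest_point X y - p))\<^sup>2 / 2"
      using near start \<rho> by (intro energy_eq_norm_diff X_closed X(2) p) auto
    moreover have "(norm (closest_point X y - p))\<^sup>2 \<le> (\<rho> / 2)\<^sup>2"
      using start by (intro power_mono) auto
    ultimately show ?thesis
      by (simp add: score_0 power_divide)
  qed
  \<comment> \<open>Initial energy, noise and drift contribute at most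
    \<open>\<rho>\<^sup>2 / 8\<close> each, and their total stays below the energy level
    \<open>\<rho>\<^sup>2 / 2\<close> that corresponds to distance \<open>\<rho>\<close>.\<close>
  have close: "norm (iterate n s - p) < \<rho>"
    if "energy X p (score n s) \<le> energy X p (score 0 s) - (\<Sum>k<n. noise k s) + (\<Sum>k<n. drift k s)" for n
  proof -
    have "(norm (iterate n s - p))\<^sup>2 / 2 \<le> energy X p (score n s)"
      unfolding iterate_def using X_closed X(2) p by (rule norm_diff_le_energy)
    also have "\<dots> < \<rho>\<^sup>2 / 2"
      using that e0 noise[of n] drift[of n] by linarith
    finally show ?thesis
      using \<rho> by (simp add: power2_less_imp_less)
  qed
  have "energy X p (score n s) \<le> energy X p (score 0 s) - (\<Sum>k<n. noise k s) + (\<Sum>k<n. drift k s)" for n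
  proof (induction n)
    case (Suc n)
    have "0 \<le> \<gamma> n * (mean_gradient (iterate n s) \<bullet> (iterate n s - p))"
      using near[OF iterate_in close[OF Suc]] steps_pos[of n] by simp
    then show ?case
      using Suc energy_step[of n s] by simp
  qed simp
  then show ?thesis
    by (rule close)
qed

text \<open>Confinement makes the reflection property available at every time, so the energy equals
  half the squared distance throughout. Linear growth of the slope then becomes a decrease
  proportional to the square root of the energy, as the deterministic recursion requires.\<close>

lemma iterates_converge:
  assumes \<rho>: "0 < \<rho>" and c: "0 < c"
    and near: "\<And>x. x \<in> X \<Longrightarrow> norm (x - p) < \<rho> \<Longrightarrow>
      2 *\<^sub>R x - p \<in> X \<and> c * norm (x - p) \<le> mean_gradient x \<bullet> (x - p)"
    and start: "norm (closest_point X y - p) < \<rho> / 2"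
    and noise: "\<And>n. \<bar>\<Sum>k<n. noise k s\<bar> < \<rho>\<^sup>2 / 8" and drift: "\<And>n. (\<Sum>k<n. drift k s) < \<rho>\<^sup>2 / 8"
    and sm: "summable (\<lambda>n. noise n s)" "summable (\<lambda>n. drift n s)"
  shows "(\<lambda>n. iterate n s) \<longlonglongrightarrow> p"
proof -
  have stay: "norm (iterate n s - p) < \<rho>" for n
  proof (rule iterates_near[OF \<rho> _ start noise drift])
    fix x assume "x \<in> X" "norm (x - p) < \<rho>"
    moreover have "0 \<le> c * norm (x - p)"
      using c by simp
    ultimately show "2 *\<^sub>R x - p \<in> X \<and> 0 \<le> mean_gradient x \<bullet> (x - p)"
      using near[of x] by linarith
  qed
  define e where "e n = energy X p (score n s)" for n
  have e: "e n = (norm (iterate n s - p))\<^sup>2 / 2" for n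
    unfolding e_def iterate_def
    using near[OF iterate_in stay[of n]] by (intro energy_eq_norm_diff X_closed X(2) p) (simp add: iterate_def)
  have "e \<longlonglongrightarrow> 0"
  proof (rule perturbed_descent_tendsto_zero[where \<xi> = "\<lambda>n. drift n s - noise n s"])
    show "0 \<le> e n" for n
      by (simp add: e)
    show "e (Suc n) \<le> e n - \<gamma> n * (c * sqrt (e n)) + (drift n s - noise n s)" for n
    proof -
      have "sqrt (e n) \<le> norm (iterate n s - p)"
        by (rule real_le_lsqrt) (auto simp: e)
      then have "c * sqrt (e n) \<le> c * norm (iterate n s - p)"
        using c by simp
      also have "\<dots> \<le> mean_gradient (iterate n s) \<bullet> (iterate n s - p)"
        using near[OF iterate_in stay] by simp
      finally have "\<gamma> n * (c * sqrt (e n)) \<le> \<gamma> n * (mean_gradient (iterate n s) \<bullet> (iterate n s - p))"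
        using steps_pos[of n] by simp
      then show ?thesis
        using energy_step[of n s] unfolding e_def by linarith
    qed
    show "summable (\<lambda>n. drift n s - noise n s)"
      using sm(2,1) by (rule summable_diff)
  qed (use c steps_pos steps_diverge in auto)
  then have "(\<lambda>n. sqrt (2 * e n)) \<longlonglongrightarrow> sqrt (2 * 0)"
    by (intro tendsto_intros)
  then have "(\<lambda>n. norm (iterate n s - p)) \<longlonglongrightarrow> 0"
    by (simp add: e)
  then show ?thesis
    by (simp add: tendsto_norm_zero_iff LIM_zero_iff)
qed

text \<open>A union bound over the two bad events, noise or drift reaching
  \<open>\<rho>\<^sup>2 / 8\<close>. Kolmogorov's inequality divides by the square of this level,
  hence the factor 256 and \<open>\<rho> ^ 4\<close>; Markov's divides by the level itself, hence
  \<open>4 * V\<^sup>2 / \<rho>\<^sup>2\<close>.\<close>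

lemma convergence_probability:
  assumes \<rho>: "0 < \<rho>" and c: "0 < c"
    and near: "\<And>x. x \<in> X \<Longrightarrow> norm (x - p) < \<rho> \<Longrightarrow>
      2 *\<^sub>R x - p \<in> X \<and> c * norm (x - p) \<le> mean_gradient x \<bullet> (x - p)"
    and start: "norm (closest_point X y - p) < \<rho> / 2"
  shows "1 - (\<Sum>n. (\<gamma> n)\<^sup>2) * (256 * V\<^sup>2 * (diameter X)\<^sup>2 / \<rho> ^ 4 + 4 * V\<^sup>2 / \<rho>\<^sup>2)
    \<le> S.prob {s \<in> space S. (\<lambda>n. iterate n s) \<longlonglongrightarrow> p}"
proof -
  let ?\<epsilon> = "\<rho>\<^sup>2 / 8" and ?\<Gamma> = "\<Sum>n. (\<gamma> n)\<^sup>2"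
  define B1 where "B1 = {s \<in> space S. \<exists>n. ?\<epsilon> \<le> \<bar>N.partial_sum n s\<bar>}"
  define B2 where "B2 = {s \<in> space S. \<exists>n. ?\<epsilon> \<le> (\<Sum>k<n. drift k s)}"
  define C where "C = {s \<in> space S. (\<lambda>n. iterate n s) \<longlonglongrightarrow> p}"
  have [measurable]: "drift n \<in> borel_measurable S" for n
    using drift_integrable by (rule borel_measurable_integrable)
  have sets: "B1 \<in> S.events" "B2 \<in> S.events"
    unfolding B1_def B2_def by measurable
  have C: "C \<in> S.events"
    unfolding C_def by measurable
  have \<epsilon>: "0 < ?\<epsilon>" using \<rho> by simp
  have "S.prob B1 \<le> (\<Sum>n. S.expectation (\<lambda>s. (noise n s)\<^sup>2)) / ?\<epsilon>\<^sup>2"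
    unfolding B1_def using \<epsilon> noise_second_moment_summable by (rule N.maximal_inequality_infinite)
  also have "\<dots> \<le> ?\<Gamma> * (4 * V\<^sup>2 * (diameter X)\<^sup>2) / ?\<epsilon>\<^sup>2"
    using noise_second_moment_suminf by (rule divide_right_mono) simp
  also have "\<dots> = ?\<Gamma> * (256 * V\<^sup>2 * (diameter X)\<^sup>2 / \<rho> ^ 4)"
    using \<rho> by (simp add: field_simps power2_eq_square power4_eq_xxxx)
  finally have B1: "S.prob B1 \<le> ?\<Gamma> * (256 * V\<^sup>2 * (diameter X)\<^sup>2 / \<rho> ^ 4)" .
  have "S.prob B2 \<le> ?\<Gamma> * (V\<^sup>2 / 2) / ?\<epsilon>"
    unfolding B2_def
    by (rule S.nonneg_series_maximal_inequality[OF drift_integrable drift_nonneg \<epsilon> drift_expectation_sum])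
  also have "\<dots> = ?\<Gamma> * (4 * V\<^sup>2 / \<rho>\<^sup>2)"
    using \<rho> by (simp add: field_simps)
  finally have B2: "S.prob B2 \<le> ?\<Gamma> * (4 * V\<^sup>2 / \<rho>\<^sup>2)" .
  have "AE s in S. s \<notin> B1 \<union> B2 \<longrightarrow> s \<in> C"
    using N.AE_summable[OF noise_second_moment_summable]
      S.AE_summable_nonneg[OF drift_integrable drift_nonneg drift_expectation_sum] AE_space
  proof eventually_elim
    case (elim s)
    show ?case
    proof
      assume "s \<notin> B1 \<union> B2"
      then have "\<And>n. \<bar>\<Sum>k<n. noise k s\<bar> < ?\<epsilon>" "\<And>n. (\<Sum>k<n. drift k s) < ?\<epsilon>"
        using elim(3) by (auto simp: B1_def B2_def N.partial_sum_def not_le)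
      from iterates_converge[OF \<rho> c near start this elim(1,2)] show "s \<in> C"
        using elim(3) by (simp add: C_def)
    qed
  qed
  then have "AE s in S. s \<in> space S - (B1 \<union> B2) \<longrightarrow> s \<in> C"
    by eventually_elim auto
  then have "S.prob (space S - (B1 \<union> B2)) \<le> S.prob C"
    using C by (rule S.finite_measure_mono_AE)
  moreover have "S.prob (space S - (B1 \<union> B2)) = 1 - S.prob (B1 \<union> B2)"
    using sets by (intro S.prob_compl) auto
  moreover have "S.prob (B1 \<union> B2) \<le> S.prob B1 + S.prob B2"
    using sets by (intro measure_Un_le)
  ultimately show ?thesis
    using B1 B2 unfolding C_def by (simp add: distrib_left)
qed

end

section \<open>Regularizing the oracle and choosing neighborhood and threshold\<close>

theorem corollary6p8:
  fixes X :: "'a::euclidean_space set"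
    and M :: "'w measure"
    and F :: "'a \<Rightarrow> 'w \<Rightarrow> real"
    and G :: "'a \<Rightarrow> 'w \<Rightarrow> 'a"
    and f :: "'a \<Rightarrow> real"
    and V :: real
    and xstar :: 'a
  assumes "polytope X" and "X \<noteq> {}"
    and "prob_space M" and "complete_measure M"
    and "\<And>x. x \<in> X \<Longrightarrow> integrable M (F x)"
    and "\<And>x. x \<in> X \<Longrightarrow> f x = prob_space.expectation M (F x)"
    and "strictly_concave_on X f"
    and "AE \<omega> in M. continuously_differentiable_on_with_gradient X (\<lambda>x. F x \<omega>) (\<lambda>x. G x \<omega>)"
    and "\<And>x. x \<in> X \<Longrightarrow> G x \<in> borel_measurable M"
    and "0 \<le> V"
    and "\<And>x. x \<in> X \<Longrightarrow> integrable M (\<lambda>\<omega>. (norm (G x \<omega>))\<^sup>2)"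
    and "\<And>x. x \<in> X \<Longrightarrow> prob_space.expectation M (\<lambda>\<omega>. (norm (G x \<omega>))\<^sup>2) \<le> V\<^sup>2"
    and "local_minimum_on X f xstar"
  shows "\<exists>U. openin (top_of_set X) U \<and> xstar \<in> U \<and>
           (\<forall>\<delta>>0. \<exists>\<eta>>0. \<forall>\<gamma> y (S :: 's measure) \<omega>.
              admissible_steps \<gamma> \<longrightarrow> (\<Sum>n. (\<gamma> n)\<^sup>2) \<le> \<eta> \<longrightarrow>
              prob_space S \<longrightarrow> iid_samples S M \<omega> \<longrightarrow>
              closest_point X y \<in> U \<longrightarrow>
              1 - \<delta> \<le> lazy_sgd_convergence_prob S \<omega> X G \<gamma> y xstar)"
proof -
  interpret M: prob_space M by fact
  have X: "compact X" "convex X" "closed X"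
    using \<open>polytope X\<close> polytope_imp_compact polytope_imp_convex compact_imp_closed by blast+
  obtain N where N: "N \<in> null_sets M"
    and good: "\<And>\<omega>. \<omega> \<in> space M - N \<Longrightarrow>
      continuously_differentiable_on_with_gradient X (\<lambda>x. F x \<omega>) (\<lambda>x. G x \<omega>)"
    using assms(8) by (rule AE_E3) (rule that)
  have [measurable]: "N \<in> sets M"
    using N by blast
  have AE_N: "AE \<omega> in M. \<omega> \<notin> N"
    using N by (rule AE_not_in)
  have cp_in: "closest_point X x \<in> X" for x
    using X(3) \<open>X \<noteq> {}\<close> by (rule closest_point_in_set)
  \<comment> \<open>\<open>G\<close> is arbitrary on \<open>N\<close> and outside \<open>X\<close>; \<open>H\<close> agrees with it almost surely on \<open>X\<close> and is a
    Caratheodory function, hence jointly measurable.\<close>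
  define H where "H x \<omega> = (if \<omega> \<in> N then 0 else G (closest_point X x) \<omega>)" for x \<omega>
  have H_meas: "H x \<in> borel_measurable M" for x
  proof -
    have [measurable]: "G (closest_point X x) \<in> borel_measurable M"
      using assms(9) cp_in by blast
    show ?thesis
      unfolding H_def[abs_def] by measurable
  qed
  have H_AE: "AE \<omega> in M. (norm (H x \<omega>))\<^sup>2 = (norm (G (closest_point X x) \<omega>))\<^sup>2" for x
    using AE_N by eventually_elim (simp add: H_def)
  have G_sq_int: "integrable M (\<lambda>\<omega>. (norm (G (closest_point X x) \<omega>))\<^sup>2)" for x
    using assms(11) cp_in by blast
  interpret stochastic_gradient_oracle M H V
  proof
    show "H x \<in> borel_measurable M" for x
      by (rule H_meas)
    show "continuous_on UNIV (\<lambda>x. H x \<omega>)" if "\<omega> \<in> space M" for \<omega>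
    proof (cases "\<omega> \<in> N")
      case True
      then show ?thesis by (simp add: H_def)
    next
      case False
      then have "continuous_on X (\<lambda>x. G x \<omega>)"
        using good[of \<omega>] that by (simp add: continuously_differentiable_on_with_gradient_def)
      then have "continuous_on UNIV (\<lambda>x. G (closest_point X x) \<omega>)"
        using continuous_on_closest_point[OF X(2,3) \<open>X \<noteq> {}\<close>]
        by (rule continuous_on_compose2) (use cp_in in auto)
      then show ?thesis using False by (simp add: H_def)
    qed
    show "integrable M (\<lambda>\<omega>. (norm (H x \<omega>))\<^sup>2)" for x
      using G_sq_int[of x] H_meas[of x] H_AE[of x]
      by (subst integrable_cong_AE[where g = "\<lambda>\<omega>. (norm (G (closest_point X x) \<omega>))\<^sup>2"]) auto
    have "M.expectation (\<lambda>\<omega>. (norm (H x \<omega>))\<^sup>2) = M.expectation (\<lambda>\<omega>. (norm (G (closest_point X x) \<omega>))\<^sup>2)" for x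
      using G_sq_int[of x] H_meas[of x] H_AE[of x] by (intro integral_cong_AE) auto
    then show "M.expectation (\<lambda>\<omega>. (norm (H x \<omega>))\<^sup>2) \<le> V\<^sup>2" for x
      using assms(12) cp_in by simp
  qed
  have deriv: "AE \<omega> in M. \<forall>x\<in>X. ((\<lambda>x. F x \<omega>) has_derivative (\<lambda>v. H x \<omega> \<bullet> v)) (at x within X)"
    using AE_N AE_space
  proof eventually_elim
    case (elim \<omega>)
    then show ?case
      using good[of \<omega>] by (simp add: H_def continuously_differentiable_on_with_gradient_def closest_point_self)
  qed
  have xstar: "xstar \<in> X"
    using \<open>local_minimum_on X f xstar\<close> openin_imp_subset unfolding local_minimum_on_def by blast
  have pos: "0 < mean_gradient xstar \<bullet> (x - xstar)" if "x \<in> X" "x \<noteq> xstar" for x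
    using assms(5,6) deriv assms(7,13) that by (rule mean_gradient_pos_at_local_minimum)
  obtain c r where c: "0 < c" and r: "0 < r"
    and sharp: "\<And>x. x \<in> X \<Longrightarrow> c * norm (x - xstar) \<le> mean_gradient xstar \<bullet> (x - xstar)"
    and reflect: "\<And>x. x \<in> X \<Longrightarrow> norm (x - xstar) < r \<Longrightarrow> 2 *\<^sub>R x - xstar \<in> X"
    using polytope_sharp[OF \<open>polytope X\<close> xstar pos] by metis
  obtain r' where r': "0 < r'"
    and close: "\<And>x. norm (x - xstar) < r' \<Longrightarrow> norm (mean_gradient x - mean_gradient xstar) < c / 2"
    using mean_gradient_continuous c unfolding continuous_on_iff dist_norm by (metis UNIV_I half_gt_zero)
  \<comment> \<open>Within \<open>\<rho>\<close> reflections stay in \<open>X\<close>, and the mean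
    gradient differs from its value at \<open>xstar\<close> by less than \<open>c / 2\<close>, so
    half of the sharpness constant survives.\<close>
  define \<rho> where "\<rho> = min r r'"
  have \<rho>: "0 < \<rho>" using r r' by (simp add: \<rho>_def)
  have near: "2 *\<^sub>R x - xstar \<in> X \<and> c / 2 * norm (x - xstar) \<le> mean_gradient x \<bullet> (x - xstar)"
    if "x \<in> X" "norm (x - xstar) < \<rho>" for x
  proof
    show "2 *\<^sub>R x - xstar \<in> X"
      using reflect that by (simp add: \<rho>_def)
    have "\<bar>(mean_gradient x - mean_gradient xstar) \<bullet> (x - xstar)\<bar>
        \<le> norm (mean_gradient x - mean_gradient xstar) * norm (x - xstar)"
      by (rule Cauchy_Schwarz_ineq2)
    also have "\<dots> \<le> c / 2 * norm (x - xstar)"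
      using close[of x] that(2) by (intro mult_right_mono) (auto simp: \<rho>_def)
    finally show "c / 2 * norm (x - xstar) \<le> mean_gradient x \<bullet> (x - xstar)"
      using sharp[OF that(1)] unfolding inner_diff_left abs_le_iff by argo
  qed
  define K where "K = 256 * V\<^sup>2 * (diameter X)\<^sup>2 / \<rho> ^ 4 + 4 * V\<^sup>2 / \<rho>\<^sup>2"
  have K: "0 \<le> K"
    using \<rho> by (simp add: K_def)
  \<comment> \<open>The neighborhood depends only on \<open>\<rho>\<close> and is therefore fixed
    before \<open>\<delta>\<close>.\<close>
  show ?thesis
  proof (rule exI[of _ "X \<inter> ball xstar (\<rho> / 2)"], intro conjI allI impI)
    show "openin (top_of_set X) (X \<inter> ball xstar (\<rho> / 2))"
      by (simp add: openin_open_Int)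
    show "xstar \<in> X \<inter> ball xstar (\<rho> / 2)"
      using xstar \<rho> by simp
    fix \<delta> :: real assume \<delta>: "0 < \<delta>"
    show "\<exists>\<eta>>0. \<forall>\<gamma> y (S :: 's measure) \<omega>.
        admissible_steps \<gamma> \<longrightarrow> (\<Sum>n. (\<gamma> n)\<^sup>2) \<le> \<eta> \<longrightarrow>
        prob_space S \<longrightarrow> iid_samples S M \<omega> \<longrightarrow>
        closest_point X y \<in> X \<inter> ball xstar (\<rho> / 2) \<longrightarrow>
        1 - \<delta> \<le> lazy_sgd_convergence_prob S \<omega> X G \<gamma> y xstar"
    \<comment> \<open>The failure probability is at most \<open>K\<close> times the sum of squared
      steps; \<open>K + 1\<close> avoids division by zero when \<open>K = 0\<close>.\<close>
    proof (rule exI[of _ "\<delta> / (K + 1)"], intro conjI allI impI)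
      show "0 < \<delta> / (K + 1)"
        using \<delta> K by simp
      fix \<gamma> y and S :: "'s measure" and \<omega>
      assume \<gamma>: "admissible_steps \<gamma>" and small: "(\<Sum>n. (\<gamma> n)\<^sup>2) \<le> \<delta> / (K + 1)"
        and S: "prob_space S" and iid: "iid_samples S M \<omega>"
        and y: "closest_point X y \<in> X \<inter> ball xstar (\<rho> / 2)"
      interpret S: prob_space S by fact
      interpret lazy_sgd_process M H V S X \<omega> \<gamma> y xstar
        by unfold_locales (use X xstar iid \<gamma> in auto)
      define C where "C = {s \<in> space S. (\<lambda>n. lazy_sgd X G \<gamma> y (\<lambda>k. \<omega> k s) n) \<longlonglongrightarrow> xstar}"
      define C' where "C' = {s \<in> space S. (\<lambda>n. iterate n s) \<longlonglongrightarrow> xstar}"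
      have C': "C' \<in> sets S"
        unfolding C'_def by measurable
      \<comment> \<open>Each sample has law \<open>M\<close>, so almost surely none of the countably
        many samples hits \<open>N\<close>, and the runs driven by \<open>G\<close> and by
        \<open>H\<close> coincide.\<close>
      have "AE s in S. \<omega> n s \<notin> N" for n
        by (rule AE_distrD[OF sample_measurable]) (unfold distr_sample, rule AE_N)
      then have "AE s in S. \<forall>n. \<omega> n s \<notin> N"
        by (simp add: AE_all_countable)
      then have "AE s in S. s \<in> C' \<longleftrightarrow> s \<in> C"
      proof eventually_elim
        case (elim s)
        have "lazy_sgd_score X G \<gamma> y (\<lambda>k. \<omega> k s) n = lazy_sgd_score X H \<gamma> y (\<lambda>k. \<omega> k s) n" for n
          using elim by (induction n) (simp_all add: H_def closest_point_self[OF cp_in])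
        then show ?case
          by (simp add: C_def C'_def lazy_sgd_def iterate_def score_def)
      qed
      then have AE_C: "AE s in completion S. s \<in> C' \<longleftrightarrow> s \<in> C"
        by (rule AE_completion)
      \<comment> \<open>\<open>C\<close> may fail to be measurable in \<open>S\<close>; it differs
        from the event \<open>C'\<close> of \<open>S\<close> only by a null set, which suffices in
        the completion.\<close>
      have "C \<in> sets (completion S)"
        using C' by (intro completion.in_sets_AE[OF AE_C]) (auto simp: C_def)
      then have "measure (completion S) C = measure (completion S) C'"
        using C' AE_C by (intro measure_eq_AE) auto
      then have prob: "lazy_sgd_convergence_prob S \<omega> X G \<gamma> y xstar = S.prob C'"
        using C' by (simp add: lazy_sgd_convergence_prob_def C_def)
      have "norm (closest_point X y - xstar) < \<rho> / 2"
        using y by (simp add: dist_norm norm_minus_commute)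
      with \<rho> have "1 - (\<Sum>n. (\<gamma> n)\<^sup>2) * K \<le> S.prob C'"
        unfolding K_def C'_def using near c by (intro convergence_probability[of \<rho> "c / 2"]) auto
      moreover have "(\<Sum>n. (\<gamma> n)\<^sup>2) * K \<le> \<delta>"
      proof -
        have "(\<Sum>n. (\<gamma> n)\<^sup>2) * K \<le> \<delta> / (K + 1) * K"
          using small K by (rule mult_right_mono)
        also have "\<dots> \<le> \<delta>"
          using \<delta> K by (simp add: field_simps)
        finally show ?thesis .
      qed
      ultimately show "1 - \<delta> \<le> lazy_sgd_convergence_prob S \<omega> X G \<gamma> y xstar"
        unfolding prob by linarith
    qed
  qed
qed

end
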